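(* Let $\Psi=(\psi,\psi^* ):\mathcal{M}=(M,\mathcal{A}_M)\to\mathcal{N}=(N,\mathcal{B}_N)$ be a morphism of $\mathbb{Z}_2^n$-supermanifolds. Then $\Psi$ is continuous with respect to $\mathcal{J}$ and $\mathfrak{m}$, i.e., for every open $V\subset N$ and every $m\in M$, $$\psi_V^*\big(\mathcal{J}_N(V)\big)\subset\mathcal{J}_M(\psi^{-1}(V))\qquad\text{and}\qquad \psi_m^*\big(\mathfrak{m}_{\psi(m)}\big)\subset\mathfrak{m}_m .$$
   Context: Fix $n\in\mathbb{N}$. $\mathbb{Z}_2=\{0,1\}$, and $\langle i,j\rangle=\sum_k i_kj_k$ for $i,j\in\mathbb{Z}_2^n$. A $\mathbb{Z}_2^n$-commutative associative unital $\mathbb{R}$-algebra is a $\mathbb{Z}_2^n$-graded associative unital $\mathbb{R}$-algebra $A=\bigoplus_{i\in\mathbb{Z}_2^n}A^i$ with $ab=(-1)^{\langle i,j\rangle}ba$ for $a\in A^i$, $b\in A^j$. Superdomains. Order $\mathbb{Z}_2^n\setminus\{0\}$ lexicographically. Let $p\in\mathbb{N}$, $\mathbf{q}=(q_1,\dots,q_{2^n-1})\in\mathbb{N}^{2^n-1}$, $q=\sum_kq_k$, and let $\xi^1,\dots,\xi^q$ be formal variables with degrees in $\mathbb{Z}_2^n\setminus\{0\}$, exactly $q_k$ of them having as degree the $k$-th element of $\mathbb{Z}_2^n\setminus\{0\}$. For $U\subset\mathbb{R}^p$ open, $C^\infty_U[[\xi^1,\dots,\xi^q]]$ denotes the sheaf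 $V\mapsto C^\infty(V)[[\xi^1,\dots,\xi^q]]$ of formal power series $\sum_\mu f_\mu(x)\xi^\mu$ with $f_\mu\in C^\infty(V)$, where functions of $x$ have degree $0$ and are central, and $\xi^a\xi^b=(-1)^{\langle\deg\xi^a,\deg\xi^b\rangle}\xi^b\xi^a$ (variables with odd $\langle\deg\xi^a,\deg\xi^a\rangle$ thus occur with exponent at most 1). The pair $(U,C^\infty_U[[\xi^1,\dots,\xi^q]])$ is a $\mathbb{Z}_2^n$-superdomain of dimension $p|\mathbf{q}$. Supermanifolds. A locally $\mathbb{Z}_2^n$-ringed space is a pair $(M,\mathcal{A}_M)$ of a Hausdorff second-countable topological space $M$ and a sheaf $\mathcal{A}_M$ of $\mathbb{Z}_2^n$-commutative associative unital $\mathbb{R}$-algebras whose stalks $\mathcal{A}_m$ are local, i.e. have a unique maximal homogeneous ideal $\mathfrak{m}_m$. A morphism $(\psi,\psi^* ):(M,\mathcal{A}_M)\to(N,\mathcal{B}_N)$ consists of a continuous map $\psi:M\to N$ and graded unital $\mathbb{R}$-algebra morphisms $\psi_V^*:\mathcal{B}_N(V)\to\mathcal{A}_M(\psi^{-1}(V))$, $V\subset N$ open, commuting with restrictions; $\psi_m^*:\mathcal{B}_{\psi(m)}\to\mathcal{A}_m$ denotes the induced map on stalks. (The paper's definition of morphism also lists the requirement that $\psi_m^*$ respect the maximal ideals; the paper observes that for $\mathbb{Z}_2^n$-supermanifolds this corollary shows that requirement to be redundant.) A $\mathbb{Z}_2^n$-supermanifold of dimension $p|\mathbf{q}$ is a locally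 $\mathbb{Z}_2^n$-ringed space locally isomorphic to a $\mathbb{Z}_2^n$-superdomain of dimension $p|\mathbf{q}$; a morphism of $\mathbb{Z}_2^n$-supermanifolds is a morphism of locally $\mathbb{Z}_2^n$-ringed spaces. Base projection. For $U\subset M$ open, $f\in\mathcal{A}_M(U)$ and $m\in U$, $\varepsilon_U(f)(m)$ is the unique $k\in\mathbb{R}$ such that $f-k$ is not invertible in any neighborhood of $m$. (In a superdomain, $\varepsilon(\sum_\mu f_\mu\xi^\mu)=f_0$.) $\mathcal{J}_M$ is the sheaf of ideals $\mathcal{J}_M(U)=\ker\varepsilon_U\subset\mathcal{A}_M(U)$, and similarly for $\mathcal{N}$. *)

theory Defs
  imports "HOL-Analysis.Analysis" "HOL-Algebra.Module" "HOL-Algebra.Ideal" "HOL-Library.Z2"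
begin

section \<open>The grading group and its sign rule\<close>

text \<open>
  An element of $\mathbb{Z}_2^n$ is a list of length \<open>n\<close> over \<^typ>\<open>bit\<close>, the field with two
  elements; only the class modulo 2 of the product $\langle i,j\rangle$ is ever used.
\<close>

definition Z2n :: "nat \<Rightarrow> bit list set" where
  "Z2n n = {i. length i = n}"

definition z2_zero :: "nat \<Rightarrow> bit list" where
  "z2_zero n = replicate n 0"

definition z2_add :: "bit list \<Rightarrow> bit list \<Rightarrow> bit list" where
  "z2_add i j = map2 (+) i j"

definition z2_inner :: "bit list \<Rightarrow> bit list \<Rightarrow> bit" where
  "z2_inner i j = (\<Sum>k<length i. i ! k * j ! k)"

definition z2_sign :: "bit list \<Rightarrow> bit list \<Rightarrow> real" where
  "z2_sign i j = (if z2_inner i j = 1 then -1 else 1)"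

definition z2_less :: "bit list \<Rightarrow> bit list \<Rightarrow> bool" where
  "z2_less i j \<longleftrightarrow> (i, j) \<in> lexord {(0, 1)}"

text \<open>Position, counted from 0, in the lexicographic enumeration of the nonzero elements.\<close>

definition z2_position :: "nat \<Rightarrow> bit list \<Rightarrow> nat" where
  "z2_position n i = card {j \<in> Z2n n - {z2_zero n}. z2_less j i}"


section \<open>Graded-commutative real algebras\<close>

definition real_ring :: "real ring" where
  "real_ring = \<lparr>carrier = UNIV, monoid.mult = (*), one = 1, ring.zero = 0, add = (+)\<rparr>"

record 'a graded_algebra = "(real, 'a) module" +
  component :: "bit list \<Rightarrow> 'a set"

locale z2n_comm_algebra = Ring.ring A + Module.module real_ring A
  for n :: nat and A :: "'a graded_algebra" (structure) +
  assumes smult_mult_left: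
      "\<lbrakk>x \<in> carrier A; y \<in> carrier A\<rbrakk> \<Longrightarrow> (r \<odot> x) \<otimes> y = r \<odot> (x \<otimes> y)"
    and smult_mult_right:
      "\<lbrakk>x \<in> carrier A; y \<in> carrier A\<rbrakk> \<Longrightarrow> x \<otimes> (r \<odot> y) = r \<odot> (x \<otimes> y)"
    and component_submodule:
      "i \<in> Z2n n \<Longrightarrow> submodule (component A i) real_ring A"
    and component_direct_sum:
      "x \<in> carrier A \<Longrightarrow>
        \<exists>!c. c \<in> (\<Pi>\<^sub>E i\<in>Z2n n. component A i) \<and> x = finsum A c (Z2n n)"
    and one_component: "\<one> \<in> component A (z2_zero n)"
    and mult_component:
      "\<lbrakk>i \<in> Z2n n; j \<in> Z2n n; x \<in> component A i; y \<in> component A j\<rbrakk>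
        \<Longrightarrow> x \<otimes> y \<in> component A (z2_add i j)"
    and graded_commutative:
      "\<lbrakk>i \<in> Z2n n; j \<in> Z2n n; x \<in> component A i; y \<in> component A j\<rbrakk>
        \<Longrightarrow> x \<otimes> y = z2_sign i j \<odot> (y \<otimes> x)"

definition graded_hom :: "nat \<Rightarrow> 'a graded_algebra \<Rightarrow> 'b graded_algebra \<Rightarrow> ('a \<Rightarrow> 'b) set" where
  "graded_hom n A B = {h \<in> ring_hom A B.
     (\<forall>r. \<forall>x\<in>carrier A. h (r \<odot>\<^bsub>A\<^esub> x) = r \<odot>\<^bsub>B\<^esub> h x) \<and>
     (\<forall>i\<in>Z2n n. h ` component A i \<subseteq> component B i)}"

definition homogeneous_ideal :: "nat \<Rightarrow> 'a graded_algebra \<Rightarrow> 'a set \<Rightarrow> bool" where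
  "homogeneous_ideal n A I \<longleftrightarrow> ideal I A \<and>
     (\<forall>c \<in> \<Pi>\<^sub>E i\<in>Z2n n. component A i. finsum A c (Z2n n) \<in> I \<longrightarrow> (\<forall>i\<in>Z2n n. c i \<in> I))"

definition maximal_homogeneous_ideal :: "nat \<Rightarrow> 'a graded_algebra \<Rightarrow> 'a set \<Rightarrow> bool" where
  "maximal_homogeneous_ideal n A I \<longleftrightarrow> homogeneous_ideal n A I \<and> I \<noteq> carrier A \<and>
     (\<forall>J. homogeneous_ideal n A J \<and> I \<subseteq> J \<and> J \<noteq> carrier A \<longrightarrow> J = I)"

definition graded_local :: "nat \<Rightarrow> 'a graded_algebra \<Rightarrow> bool" where
  "graded_local n A \<longleftrightarrow> (\<exists>!I. maximal_homogeneous_ideal n A I)"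

definition the_maximal_ideal :: "nat \<Rightarrow> 'a graded_algebra \<Rightarrow> 'a set" where
  "the_maximal_ideal n A = (THE I. maximal_homogeneous_ideal n A I)"


section \<open>Locally ringed spaces\<close>

text \<open>
  \<open>restriction M U V\<close> is the map from sections over \<open>U\<close> to sections over \<open>V \<subseteq> U\<close>. Values of
  \<open>sections\<close> and \<open>restriction\<close> at sets that are not open are irrelevant.
\<close>

record ('m, 'a) algebraed_space =
  base_space :: "'m topology"
  sections :: "'m set \<Rightarrow> 'a graded_algebra"
  restriction :: "'m set \<Rightarrow> 'm set \<Rightarrow> 'a \<Rightarrow> 'a"

locale z2n_presheaf =
  fixes n :: nat and M :: "('m, 'a) algebraed_space"
  assumes sections_algebra:
      "openin (base_space M) U \<Longrightarrow> z2n_comm_algebra n (sections M U)"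
    and restriction_hom:
      "\<lbrakk>openin (base_space M) U; openin (base_space M) V; V \<subseteq> U\<rbrakk>
        \<Longrightarrow> restriction M U V \<in> graded_hom n (sections M U) (sections M V)"
    and restriction_id:
      "\<lbrakk>openin (base_space M) U; s \<in> carrier (sections M U)\<rbrakk> \<Longrightarrow> restriction M U U s = s"
    and restriction_comp:
      "\<lbrakk>openin (base_space M) U; openin (base_space M) V; openin (base_space M) W;
        W \<subseteq> V; V \<subseteq> U; s \<in> carrier (sections M U)\<rbrakk>
        \<Longrightarrow> restriction M V W (restriction M U V s) = restriction M U W s"

locale z2n_sheaf = z2n_presheaf n M for n :: nat and M :: "('m, 'a) algebraed_space" +
  assumes locality:
      "\<lbrakk>\<forall>W\<in>\<C>. openin (base_space M) W;
        s \<in> carrier (sections M (\<Union>\<C>)); t \<in> carrier (sections M (\<Union>\<C>));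
        \<forall>W\<in>\<C>. restriction M (\<Union>\<C>) W s = restriction M (\<Union>\<C>) W t\<rbrakk> \<Longrightarrow> s = t"
    and gluing:
      "\<lbrakk>\<forall>W\<in>\<C>. openin (base_space M) W; \<forall>W\<in>\<C>. \<sigma> W \<in> carrier (sections M W);
        \<forall>W\<in>\<C>. \<forall>W'\<in>\<C>. restriction M W (W \<inter> W') (\<sigma> W) = restriction M W' (W \<inter> W') (\<sigma> W')\<rbrakk>
        \<Longrightarrow> \<exists>s\<in>carrier (sections M (\<Union>\<C>)). \<forall>W\<in>\<C>. restriction M (\<Union>\<C>) W s = \<sigma> W"

text \<open>
  The germ at \<open>m\<close> of a section \<open>s\<close> over \<open>U\<close> is its equivalence class in the direct limit over
  the open neighbourhoods of \<open>m\<close>. The operations on germs are unions over all representatives,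
  which are unions of copies of one and the same class.
\<close>

definition germ ::
  "('m, 'a) algebraed_space \<Rightarrow> 'm \<Rightarrow> 'm set \<Rightarrow> 'a \<Rightarrow> ('m set \<times> 'a) set" where
  "germ M m U s = {(V, t). openin (base_space M) V \<and> m \<in> V \<and> t \<in> carrier (sections M V) \<and>
     (\<exists>W. openin (base_space M) W \<and> m \<in> W \<and> W \<subseteq> U \<inter> V \<and>
        restriction M U W s = restriction M V W t)}"

definition germ_op2 ::
  "('m, 'a) algebraed_space \<Rightarrow> 'm \<Rightarrow> ('a graded_algebra \<Rightarrow> 'a \<Rightarrow> 'a \<Rightarrow> 'a)
    \<Rightarrow> ('m set \<times> 'a) set \<Rightarrow> ('m set \<times> 'a) set \<Rightarrow> ('m set \<times> 'a) set" where
  "germ_op2 M m f X Y = (\<Union>(U, s)\<in>X. \<Union>(V, t)\<in>Y.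
     germ M m (U \<inter> V)
       (f (sections M (U \<inter> V)) (restriction M U (U \<inter> V) s) (restriction M V (U \<inter> V) t)))"

definition stalk :: "('m, 'a) algebraed_space \<Rightarrow> 'm \<Rightarrow> ('m set \<times> 'a) set graded_algebra" where
  "stalk M m = \<lparr>
     carrier = {germ M m U s | U s.
       openin (base_space M) U \<and> m \<in> U \<and> s \<in> carrier (sections M U)},
     monoid.mult = germ_op2 M m monoid.mult,
     one = germ M m (topspace (base_space M)) \<one>\<^bsub>sections M (topspace (base_space M))\<^esub>,
     ring.zero = germ M m (topspace (base_space M)) \<zero>\<^bsub>sections M (topspace (base_space M))\<^esub>,
     add = germ_op2 M m add,
     smult = (\<lambda>r X. \<Union>(U, s)\<in>X. germ M m U (r \<odot>\<^bsub>sections M U\<^esub> s)),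
     component = (\<lambda>i. {germ M m U s | U s.
       openin (base_space M) U \<and> m \<in> U \<and> s \<in> component (sections M U) i})\<rparr>"

locale locally_z2n_ringed_space = z2n_sheaf n M
  for n :: nat and M :: "('m, 'a) algebraed_space" +
  assumes hausdorff: "Hausdorff_space (base_space M)"
    and second_countable: "second_countable (base_space M)"
    and local_stalks: "m \<in> topspace (base_space M) \<Longrightarrow> graded_local n (stalk M m)"

definition stalk_ideal :: "nat \<Rightarrow> ('m, 'a) algebraed_space \<Rightarrow> 'm \<Rightarrow> ('m set \<times> 'a) set set" where
  "stalk_ideal n M m = the_maximal_ideal n (stalk M m)"


section \<open>Morphisms\<close>

definition preimage :: "('m, 'a) algebraed_space \<Rightarrow> ('m \<Rightarrow> 'k) \<Rightarrow> 'k set \<Rightarrow> 'm set" where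
  "preimage M \<psi> V = {x \<in> topspace (base_space M). \<psi> x \<in> V}"

text \<open>
  Compatibility of the induced stalk maps with the maximal ideals is deliberately not part of the
  notion: for supermanifolds it is a consequence.
\<close>

locale z2n_morphism =
  fixes n :: nat
    and M :: "('m, 'a) algebraed_space" and N :: "('k, 'b) algebraed_space"
    and \<psi> :: "'m \<Rightarrow> 'k" and \<psi>s :: "'k set \<Rightarrow> 'b \<Rightarrow> 'a"
  assumes continuous: "continuous_map (base_space M) (base_space N) \<psi>"
    and pullback_hom:
      "openin (base_space N) V
        \<Longrightarrow> \<psi>s V \<in> graded_hom n (sections N V) (sections M (preimage M \<psi> V))"
    and pullback_restriction:
      "\<lbrakk>openin (base_space N) U; openin (base_space N) V; V \<subseteq> U; s \<in> carrier (sections N U)\<rbrakk>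
        \<Longrightarrow> \<psi>s V (restriction N U V s)
           = restriction M (preimage M \<psi> U) (preimage M \<psi> V) (\<psi>s U s)"

definition stalk_map ::
  "('m, 'a) algebraed_space \<Rightarrow> ('m \<Rightarrow> 'k) \<Rightarrow> ('k set \<Rightarrow> 'b \<Rightarrow> 'a) \<Rightarrow> 'm
    \<Rightarrow> ('k set \<times> 'b) set \<Rightarrow> ('m set \<times> 'a) set" where
  "stalk_map M \<psi> \<psi>s m X = (\<Union>(V, t)\<in>X. germ M m (preimage M \<psi> V) (\<psi>s V t))"

definition z2n_isomorphic ::
  "nat \<Rightarrow> ('m, 'a) algebraed_space \<Rightarrow> ('k, 'b) algebraed_space \<Rightarrow> bool" where
  "z2n_isomorphic n M N \<longleftrightarrow> (\<exists>\<psi> \<psi>s \<phi> \<phi>s.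
     z2n_morphism n M N \<psi> \<psi>s \<and> z2n_morphism n N M \<phi> \<phi>s \<and>
     (\<forall>x\<in>topspace (base_space M). \<phi> (\<psi> x) = x) \<and>
     (\<forall>y\<in>topspace (base_space N). \<psi> (\<phi> y) = y) \<and>
     (\<forall>V. openin (base_space N) V \<longrightarrow>
        (\<forall>t\<in>carrier (sections N V). \<phi>s (preimage M \<psi> V) (\<psi>s V t) = t)) \<and>
     (\<forall>U. openin (base_space M) U \<longrightarrow>
        (\<forall>s\<in>carrier (sections M U). \<psi>s (preimage N \<phi> U) (\<phi>s U s) = s)))"

definition restrict_space_to :: "('m, 'a) algebraed_space \<Rightarrow> 'm set \<Rightarrow> ('m, 'a) algebraed_space" where
  "restrict_space_to M U = M\<lparr>base_space := subtopology (base_space M) U\<rparr>"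


section \<open>Superdomains\<close>

text \<open>
  $\mathbb{R}^p$ is \<^term>\<open>Euclidean_space p\<close>, whose points are the functions \<open>nat \<Rightarrow> real\<close>
  vanishing from \<open>p\<close> on, so that \<open>p = 0\<close> is included. Smoothness means that all iterated
  partial derivatives exist and are continuous.
\<close>

primrec Ck :: "nat \<Rightarrow> nat \<Rightarrow> (nat \<Rightarrow> real) set \<Rightarrow> ((nat \<Rightarrow> real) \<Rightarrow> real) \<Rightarrow> bool" where
  "Ck p 0 V f \<longleftrightarrow> continuous_map (subtopology (Euclidean_space p) V) euclideanreal f"
| "Ck p (Suc r) V f \<longleftrightarrow>
     continuous_map (subtopology (Euclidean_space p) V) euclideanreal f \<and>
     (\<forall>k<p. \<exists>g. (\<forall>x\<in>V. ((\<lambda>t. f (x(k := t))) has_real_derivative g x) (at (x k))) \<and> Ck p r V g)"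

text \<open>A function on \<open>V\<close> is represented by its extension by zero.\<close>

definition smooth_functions :: "nat \<Rightarrow> (nat \<Rightarrow> real) set \<Rightarrow> ((nat \<Rightarrow> real) \<Rightarrow> real) set" where
  "smooth_functions p V = {f. (\<forall>r. Ck p r V f) \<and> (\<forall>x. x \<notin> V \<longrightarrow> f x = 0)}"

text \<open>
  The list \<open>ds\<close> contains the degrees of the formal variables, which are numbered from 0; the
  exponent \<open>\<mu>\<close> stands for the product, in increasing order of \<open>a\<close>, of the powers with exponent
  \<open>\<mu> a\<close> of the variables.
\<close>

definition variable_degrees :: "nat \<Rightarrow> nat list \<Rightarrow> bit list list \<Rightarrow> bool" where
  "variable_degrees n q ds \<longleftrightarrow> length ds = sum_list q \<and> set ds \<subseteq> Z2n n - {z2_zero n} \<and>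
     (\<forall>i\<in>Z2n n - {z2_zero n}. count_list ds i = q ! z2_position n i)"

definition exponents :: "bit list list \<Rightarrow> (nat \<Rightarrow> nat) set" where
  "exponents ds = {\<mu>. (\<forall>a\<ge>length ds. \<mu> a = 0) \<and>
     (\<forall>a<length ds. z2_inner (ds ! a) (ds ! a) = 1 \<longrightarrow> \<mu> a \<le> 1)}"

definition exponent_degree :: "nat \<Rightarrow> bit list list \<Rightarrow> (nat \<Rightarrow> nat) \<Rightarrow> bit list" where
  "exponent_degree n ds \<mu> = map (\<lambda>k. \<Sum>a<length ds. of_nat (\<mu> a) * ds ! a ! k) [0..<n]"

text \<open>
  The sign arising when the product of the monomials with exponents \<open>\<mu>\<close> and \<open>\<nu>\<close> is put in
  increasing order: each variable \<open>b\<close> of the second one passes each variable \<open>a > b\<close> of the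
  first one. If \<open>\<mu> + \<nu>\<close> is not an admissible exponent, then the product is zero.
\<close>

definition exponent_sign :: "bit list list \<Rightarrow> (nat \<Rightarrow> nat) \<Rightarrow> (nat \<Rightarrow> nat) \<Rightarrow> real" where
  "exponent_sign ds \<mu> \<nu> =
     (\<Prod>a<length ds. \<Prod>b<a. z2_sign (ds ! a) (ds ! b) ^ (\<mu> a * \<nu> b))"

type_synonym series = "(nat \<Rightarrow> nat) \<Rightarrow> (nat \<Rightarrow> real) \<Rightarrow> real"

definition series_set :: "nat \<Rightarrow> bit list list \<Rightarrow> (nat \<Rightarrow> real) set \<Rightarrow> series set" where
  "series_set p ds V = {f. (\<forall>\<mu>\<in>exponents ds. f \<mu> \<in> smooth_functions p V) \<and>
     (\<forall>\<mu>. \<mu> \<notin> exponents ds \<longrightarrow> f \<mu> = (\<lambda>x. 0))}"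

definition series_mult :: "bit list list \<Rightarrow> series \<Rightarrow> series \<Rightarrow> series" where
  "series_mult ds f g = (\<lambda>\<kappa> x. if \<kappa> \<in> exponents ds
     then \<Sum>\<mu>\<in>{..\<kappa>}. exponent_sign ds \<mu> (\<kappa> - \<mu>) * f \<mu> x * g (\<kappa> - \<mu>) x else 0)"

definition series_algebra ::
  "nat \<Rightarrow> nat \<Rightarrow> bit list list \<Rightarrow> (nat \<Rightarrow> real) set \<Rightarrow> series graded_algebra" where
  "series_algebra n p ds V = \<lparr>
     carrier = series_set p ds V,
     monoid.mult = series_mult ds,
     one = (\<lambda>\<mu> x. if \<mu> = (\<lambda>a. 0) \<and> x \<in> V then 1 else 0),
     ring.zero = (\<lambda>\<mu> x. 0),
     add = (\<lambda>f g \<mu> x. f \<mu> x + g \<mu> x),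
     smult = (\<lambda>r f \<mu> x. r * f \<mu> x),
     component = (\<lambda>i. {f \<in> series_set p ds V.
       \<forall>\<mu>\<in>exponents ds. exponent_degree n ds \<mu> \<noteq> i \<longrightarrow> f \<mu> = (\<lambda>x. 0)})\<rparr>"

definition superdomain ::
  "nat \<Rightarrow> nat \<Rightarrow> bit list list \<Rightarrow> (nat \<Rightarrow> real) set \<Rightarrow> (nat \<Rightarrow> real, series) algebraed_space" where
  "superdomain n p ds U = \<lparr>
     base_space = subtopology (Euclidean_space p) U,
     sections = series_algebra n p ds,
     restriction = (\<lambda>V W f \<mu> x. if x \<in> W then f \<mu> x else 0)\<rparr>"


section \<open>Supermanifolds\<close>

locale z2n_supermanifold = locally_z2n_ringed_space n M
  for n p :: nat and q :: "nat list" and M :: "('m, 'a) algebraed_space" +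
  assumes dimension_length: "length q = 2 ^ n - 1"
    and local_charts:
      "m \<in> topspace (base_space M) \<Longrightarrow> \<exists>U V ds.
         openin (base_space M) U \<and> m \<in> U \<and> openin (Euclidean_space p) V \<and>
         variable_degrees n q ds \<and>
         z2n_isomorphic n (restrict_space_to M U) (superdomain n p ds V)"

definition base_projection ::
  "('m, 'a) algebraed_space \<Rightarrow> 'm set \<Rightarrow> 'a \<Rightarrow> 'm \<Rightarrow> real" where
  "base_projection M U f m = (THE k. \<forall>W. openin (base_space M) W \<and> m \<in> W \<and> W \<subseteq> U \<longrightarrow>
     restriction M U W (f \<ominus>\<^bsub>sections M U\<^esub> k \<odot>\<^bsub>sections M U\<^esub> \<one>\<^bsub>sections M U\<^esub>)
       \<notin> Units (sections M W))"

definition base_kernel :: "('m, 'a) algebraed_space \<Rightarrow> 'm set \<Rightarrow> 'a set" where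
  "base_kernel M U = {f \<in> carrier (sections M U). \<forall>m\<in>U. base_projection M U f m = 0}"

end

theory Submission
  imports Defs
begin

text \<open>
  At each point \<open>m\<close> of a supermanifold, evaluating the coefficient of the zero exponent in a chart
  defines a unital algebra morphism from the sections near \<open>m\<close> to \<open>\<real>\<close>, compatible with
  restriction. A section is invertible near \<open>m\<close> if its value is nonzero, since a series whose
  zeroth coefficient has no zeros can be inverted recursively. Hence this evaluation is the only
  such morphism: if another one \<open>\<theta>'\<close> had \<open>\<theta>' s \<noteq> \<theta> s\<close>, then \<open>s - \<theta>' s\<close> would be invertible near \<open>m\<close>,
  although \<open>\<theta>'\<close> annihilates it. It follows that evaluation computes the base projection, that its
  kernel is the maximal homogeneous ideal of the stalk, and that a morphism of supermanifolds, along
  which evaluation at \<open>m\<close> pulls back to such a morphism at \<open>\<psi> m\<close>, respects both ideals.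
\<close>

section \<open>Closure properties of the smoothness classes\<close>

lemma Ck_continuous:
  "Ck p r V f \<Longrightarrow> continuous_map (subtopology (Euclidean_space p) V) euclideanreal f"
  by (cases r) auto

lemma Ck_SucE:
  assumes "Ck p (Suc r) V f" "k < p"
  obtains f' where "\<And>x. x \<in> V \<Longrightarrow> ((\<lambda>t. f (x(k := t))) has_real_derivative f' x) (at (x k))"
    "Ck p r V f'"
proof -
  from assms have "\<exists>f'. (\<forall>x\<in>V. ((\<lambda>t. f (x(k := t))) has_real_derivative f' x) (at (x k)))
      \<and> Ck p r V f'" by simp
  then show thesis using that by blast
qed

lemma Ck_SucI:
  assumes "continuous_map (subtopology (Euclidean_space p) V) euclideanreal f"
    and "\<And>k. k < p \<Longrightarrow> \<exists>f'. (\<forall>x\<in>V. ((\<lambda>t. f (x(k := t))) has_real_derivative f' x) (at (x k)))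
      \<and> Ck p r V f'"
  shows "Ck p (Suc r) V f"
  using assms by simp

text \<open>The same partial derivatives serve as witnesses, one order lower by induction. The
  product and quotient rules rely on this: next to the derivatives they contain the functions
  themselves, for which the lower order is then required.\<close>

lemma Ck_mono: "Ck p (Suc r) V f \<Longrightarrow> Ck p r V f"
proof (induction r arbitrary: f)
  case (Suc r)
  have "\<exists>f'. (\<forall>x\<in>V. ((\<lambda>t. f (x(k := t))) has_real_derivative f' x) (at (x k))) \<and> Ck p r V f'"
    if k: "k < p" for k
  proof -
    obtain f' where f': "\<And>x. x \<in> V \<Longrightarrow> ((\<lambda>t. f (x(k := t))) has_real_derivative f' x) (at (x k))"
      and Cf': "Ck p (Suc r) V f'"
      using Ck_SucE[OF Suc.prems k] by blast
    show ?thesis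
      by (intro exI[of _ f'] conjI ballI f' Suc.IH[OF Cf'])
  qed
  then show ?case
    by (rule Ck_SucI[OF Ck_continuous[OF Suc.prems]])
qed simp

lemma Ck_const: "Ck p r V (\<lambda>x. c)"
proof (induction r arbitrary: c)
  case (Suc r)
  have "\<exists>g. (\<forall>x\<in>V. ((\<lambda>t. c) has_real_derivative g x) (at (x k))) \<and> Ck p r V g" for k
    by (rule exI[of _ "\<lambda>x. 0"]) (simp add: Suc)
  then show ?case by simp
qed simp

lemma Ck_add:
  assumes "Ck p r V f" "Ck p r V g"
  shows "Ck p r V (\<lambda>x. f x + g x)"
  using assms
proof (induction r arbitrary: f g)
  case 0
  then show ?case by (simp add: continuous_map_add)
next
  case (Suc r)
  have "\<exists>h. (\<forall>x\<in>V. ((\<lambda>t. f (x(k := t)) + g (x(k := t))) has_real_derivative h x) (at (x k)))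
          \<and> Ck p r V h" if k: "k < p" for k
  proof -
    obtain f' where f': "\<And>x. x \<in> V \<Longrightarrow> ((\<lambda>t. f (x(k := t))) has_real_derivative f' x) (at (x k))"
      and Cf': "Ck p r V f'"
      using Ck_SucE[OF Suc.prems(1) k] by blast
    obtain g' where g': "\<And>x. x \<in> V \<Longrightarrow> ((\<lambda>t. g (x(k := t))) has_real_derivative g' x) (at (x k))"
      and Cg': "Ck p r V g'"
      using Ck_SucE[OF Suc.prems(2) k] by blast
    show ?thesis
      by (intro exI[of _ "\<lambda>x. f' x + g' x"] conjI ballI DERIV_add f' g' Suc.IH Cf' Cg')
  qed
  moreover have "continuous_map (subtopology (Euclidean_space p) V) euclideanreal (\<lambda>x. f x + g x)"
    using Suc.prems by (intro continuous_map_add Ck_continuous)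
  ultimately show ?case by (intro Ck_SucI)
qed

lemma Ck_mult:
  assumes "Ck p r V f" "Ck p r V g"
  shows "Ck p r V (\<lambda>x. f x * g x)"
  using assms
proof (induction r arbitrary: f g)
  case 0
  then show ?case by (simp add: continuous_map_real_mult)
next
  case (Suc r)
  have "\<exists>h. (\<forall>x\<in>V. ((\<lambda>t. f (x(k := t)) * g (x(k := t))) has_real_derivative h x) (at (x k)))
          \<and> Ck p r V h" if k: "k < p" for k
  proof -
    obtain f' where f': "\<And>x. x \<in> V \<Longrightarrow> ((\<lambda>t. f (x(k := t))) has_real_derivative f' x) (at (x k))"
      and Cf': "Ck p r V f'"
      using Ck_SucE[OF Suc.prems(1) k] by blast
    obtain g' where g': "\<And>x. x \<in> V \<Longrightarrow> ((\<lambda>t. g (x(k := t))) has_real_derivative g' x) (at (x k))"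
      and Cg': "Ck p r V g'"
      using Ck_SucE[OF Suc.prems(2) k] by blast
    \<comment> \<open>At \<open>t = x k\<close> the updated point \<open>x(k := t)\<close> is
      \<open>x\<close> itself, so the product rule yields values at \<open>x\<close>.\<close>
    have "((\<lambda>t. f (x(k := t)) * g (x(k := t))) has_real_derivative f' x * g x + g' x * f x) (at (x k))"
      if "x \<in> V" for x
      using DERIV_mult[OF f'[OF that] g'[OF that]] by simp
    moreover have "Ck p r V (\<lambda>x. f' x * g x + g' x * f x)"
      by (intro Ck_add Suc.IH Cf' Cg' Suc.prems[THEN Ck_mono])
    ultimately show ?thesis by (intro exI conjI ballI)
  qed
  moreover have "continuous_map (subtopology (Euclidean_space p) V) euclideanreal (\<lambda>x. f x * g x)"
    using Suc.prems by (intro continuous_map_real_mult Ck_continuous)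
  ultimately show ?case by (intro Ck_SucI)
qed

lemma Ck_sum: "(\<And>i. i \<in> I \<Longrightarrow> Ck p r V (f i)) \<Longrightarrow> Ck p r V (\<lambda>x. \<Sum>i\<in>I. f i x)"
  by (induction I rule: infinite_finite_induct) (simp_all add: Ck_const Ck_add)

text \<open>Induction on the order succeeds because the derivative of the reciprocal is a product of
  the reciprocal itself, known to be of the lower order, and the derivative of
  \<open>f\<close>.\<close>

lemma Ck_inverse:
  assumes "Ck p r V f" and nz: "\<And>x. x \<in> V \<Longrightarrow> f x \<noteq> 0"
  shows "Ck p r V (\<lambda>x. inverse (f x))"
proof -
  have inv: "continuous_map (subtopology (Euclidean_space p) V) euclideanreal (\<lambda>x. inverse (f x))"
    if "Ck p r V f" for r
    using Ck_continuous[OF that] nz by (rule continuous_map_real_inverse) simp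
  show ?thesis
    using assms(1)
  proof (induction r)
    case 0
    then show ?case using inv[OF 0] by simp
  next
    case (Suc r)
    have Ci: "Ck p r V (\<lambda>x. inverse (f x))"
      by (rule Suc.IH[OF Ck_mono[OF Suc.prems]])
    have "\<exists>h. (\<forall>x\<in>V. ((\<lambda>t. inverse (f (x(k := t)))) has_real_derivative h x) (at (x k)))
            \<and> Ck p r V h" if k: "k < p" for k
    proof -
      obtain f' where f': "\<And>x. x \<in> V \<Longrightarrow> ((\<lambda>t. f (x(k := t))) has_real_derivative f' x) (at (x k))"
        and Cf': "Ck p r V f'"
        using Ck_SucE[OF Suc.prems k] by blast
      \<comment> \<open>The sign is written as the factor \<open>- 1\<close>, so that closure under
        products and constants covers it.\<close>
      have "((\<lambda>t. inverse (f (x(k := t)))) has_real_derivative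
              - 1 * (inverse (f x) * f' x * inverse (f x))) (at (x k))" if "x \<in> V" for x
        using DERIV_inverse'[OF f'[OF that]] nz[OF that] by simp
      moreover have "Ck p r V (\<lambda>x. - 1 * (inverse (f x) * f' x * inverse (f x)))"
        by (intro Ck_mult Ck_const Ci Cf')
      ultimately show ?thesis by (intro exI conjI ballI)
    qed
    moreover have "continuous_map (subtopology (Euclidean_space p) V) euclideanreal (\<lambda>x. inverse (f x))"
      by (rule inv[OF Suc.prems])
    ultimately show ?case by (intro Ck_SucI)
  qed
qed

section \<open>Exponents of monomials, their signs and degrees\<close>

lemma exponents_zero: "(\<lambda>a. 0) \<in> exponents ds"
  by (simp add: exponents_def)

lemma exponents_le: "\<kappa> \<in> exponents ds \<Longrightarrow> \<mu> \<le> \<kappa> \<Longrightarrow> \<mu> \<in> exponents ds"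
  unfolding exponents_def le_fun_def mem_Collect_eq by (metis le_trans le_zero_eq)

text \<open>An exponent vanishes beyond the last variable, so the functions below it have common
  finite support and bounded values. Finiteness is what allows a summand to be split off from the
  sum defining a product of series.\<close>

lemma finite_atMost_exponent:
  assumes "\<kappa> \<in> exponents ds"
  shows "finite {..\<kappa>}"
proof (rule finite_subset)
  show "{..\<kappa>} \<subseteq> {f. \<forall>x. (x \<in> {..<length ds} \<longrightarrow> f x \<in> {..Max (\<kappa> ` {..<length ds})}) \<and>
      (x \<notin> {..<length ds} \<longrightarrow> f x = 0)}"
  proof
    fix \<mu> assume "\<mu> \<in> {..\<kappa>}"
    then have le: "\<mu> a \<le> \<kappa> a" for a by (simp add: le_fun_def)
    have "\<mu> a \<le> Max (\<kappa> ` {..<length ds})" if "a < length ds" for a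
      using le[of a] that by (intro order_trans[OF le Max_ge]) auto
    moreover have "\<mu> a = 0" if "\<not> a < length ds" for a
      using le[of a] assms that by (simp add: exponents_def)
    ultimately show "\<mu> \<in> {f. \<forall>x. (x \<in> {..<length ds} \<longrightarrow> f x \<in> {..Max (\<kappa> ` {..<length ds})}) \<and>
      (x \<notin> {..<length ds} \<longrightarrow> f x = 0)}" by simp
  qed
next
  show "finite {f. \<forall>x. (x \<in> {..<length ds} \<longrightarrow> f x \<in> {..Max (\<kappa> ` {..<length ds})}) \<and>
      (x \<notin> {..<length ds} \<longrightarrow> f x = (0 :: nat))}" by (intro finite_set_of_finite_funs) auto
qed

lemma atMost_zero_exponent: "{..(\<lambda>a. 0 :: nat)} = {\<lambda>a. 0}"
  by (auto simp: le_fun_def)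

lemma exponent_sign_zero_left: "exponent_sign ds (\<lambda>a. 0) \<nu> = 1"
  by (simp add: exponent_sign_def)

lemma exponent_sign_zero_right: "exponent_sign ds \<mu> (\<lambda>a. 0) = 1"
  by (simp add: exponent_sign_def)

lemma exponent_degree_zero: "exponent_degree n ds (\<lambda>a. 0) = z2_zero n"
  by (simp add: exponent_degree_def z2_zero_def map_replicate_trivial)

section \<open>Inversion of formal series\<close>

text \<open>
  Solves \<open>f g = 1\<close> for the multiplication with signs \<open>\<sigma>\<close>, by recursion on the exponents. Where the
  zeroth coefficient of \<open>f\<close> vanishes, in particular outside the domain of \<open>f\<close>, the result is zero
  because \<open>inverse 0 = 0\<close>, so it is extended by zero as \<^const>\<open>smooth_functions\<close> demands.
\<close>

context
  fixes ds :: "bit list list" and \<sigma> :: "(nat \<Rightarrow> nat) \<Rightarrow> (nat \<Rightarrow> nat) \<Rightarrow> real" and f :: series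
begin

function twisted_inverse :: series where
  "twisted_inverse \<kappa> = (\<lambda>x. if \<kappa> \<in> exponents ds then
     inverse (f (\<lambda>a. 0) x) * ((if \<kappa> = (\<lambda>a. 0) then 1 else 0) +
       (\<Sum>\<mu>\<in>{..\<kappa>} - {\<lambda>a. 0}. - \<sigma> \<mu> (\<kappa> - \<mu>) * f \<mu> x * twisted_inverse (\<kappa> - \<mu>) x)) else 0)"
  by auto
termination
\<comment> \<open>The total degree drops: \<open>\<mu>\<close> is nonzero at some \<open>a\<close>,
  and \<open>\<mu> \<le> \<kappa>\<close> forces \<open>a\<close> to be the number of an actual
  variable, so that \<open>a\<close> is counted in the sum.\<close>
proof (relation "Wellfounded.measure (\<lambda>\<kappa>. \<Sum>a<length ds. \<kappa> a)")
  fix \<kappa> \<mu> :: "nat \<Rightarrow> nat"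
  assume \<kappa>: "\<kappa> \<in> exponents ds" and \<mu>: "\<mu> \<in> {..\<kappa>} - {\<lambda>a. 0}"
  then obtain a where a: "\<mu> a \<noteq> 0" by fastforce
  from \<mu> have le: "\<mu> b \<le> \<kappa> b" for b by (auto simp: le_fun_def)
  have less: "a < length ds"
  proof (rule ccontr)
    assume "\<not> a < length ds"
    with \<kappa> have "\<kappa> a = 0" by (simp add: exponents_def)
    with a le[of a] show False by simp
  qed
  have "(\<Sum>a<length ds. (\<kappa> - \<mu>) a) < (\<Sum>a<length ds. \<kappa> a)"
  proof (rule sum_strict_mono_ex1)
    show "\<exists>b\<in>{..<length ds}. (\<kappa> - \<mu>) b < \<kappa> b"
      using less a le[of a] by (intro bexI[of _ a]) auto
  qed auto
  then show "(\<kappa> - \<mu>, \<kappa>) \<in> Wellfounded.measure (\<lambda>\<kappa>. \<Sum>a<length ds. \<kappa> a)" by simp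
qed simp

declare twisted_inverse.simps [simp del]

text \<open>The recursion builds each coefficient from the reciprocal of the zeroth coefficient of
  \<open>f\<close>, the coefficients of \<open>f\<close> and earlier coefficients of the inverse, by
  sums and products only.\<close>

lemma Ck_twisted_inverse:
  assumes "\<And>\<mu>. \<mu> \<in> exponents ds \<Longrightarrow> Ck p r V (f \<mu>)"
    and "\<And>x. x \<in> V \<Longrightarrow> f (\<lambda>a. 0) x \<noteq> 0"
  shows "Ck p r V (twisted_inverse \<kappa>)"
proof (induction \<kappa> rule: twisted_inverse.induct)
  case (1 \<kappa>)
  show ?case
  proof (cases "\<kappa> \<in> exponents ds")
    case True
    have "Ck p r V (\<lambda>x. inverse (f (\<lambda>a. 0) x) * ((if \<kappa> = (\<lambda>a. 0) then 1 else 0) +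
       (\<Sum>\<mu>\<in>{..\<kappa>} - {\<lambda>a. 0}. - \<sigma> \<mu> (\<kappa> - \<mu>) * f \<mu> x * twisted_inverse (\<kappa> - \<mu>) x)))"
    proof (intro Ck_mult Ck_add Ck_sum Ck_const Ck_inverse assms exponents_zero)
      show "\<mu> \<in> exponents ds" if "\<mu> \<in> {..\<kappa>} - {\<lambda>a. 0}" for \<mu>
        using exponents_le[OF True] that by simp
    qed (use 1 True in \<open>auto simp: fun_diff_def\<close>)
    then show ?thesis by (subst twisted_inverse.simps) (simp add: True)
  next
    case False
    then show ?thesis by (subst twisted_inverse.simps) (simp add: Ck_const)
  qed
qed

lemma twisted_inverse_eq_0: "f (\<lambda>a. 0) x = 0 \<Longrightarrow> twisted_inverse \<kappa> x = 0"
  by (subst twisted_inverse.simps) simp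

lemma twisted_inverse_not_exponent: "\<kappa> \<notin> exponents ds \<Longrightarrow> twisted_inverse \<kappa> = (\<lambda>x. 0)"
  by (subst twisted_inverse.simps) simp

lemma twisted_inverse_in_series_set:
  assumes "f \<in> series_set p ds V" and nz: "\<And>x. x \<in> V \<Longrightarrow> f (\<lambda>a. 0) x \<noteq> 0"
  shows "twisted_inverse \<in> series_set p ds V"
proof -
  have "twisted_inverse \<kappa> x = 0" if "x \<notin> V" for \<kappa> x
    using assms(1) that exponents_zero[of ds]
    by (intro twisted_inverse_eq_0) (auto simp: series_set_def smooth_functions_def)
  moreover have "Ck p r V (twisted_inverse \<kappa>)" for r \<kappa>
    using assms by (intro Ck_twisted_inverse) (auto simp: series_set_def smooth_functions_def)
  ultimately show ?thesis
    by (simp add: series_set_def smooth_functions_def twisted_inverse_not_exponent)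
qed

text \<open>The recursion is this equation solved for its summand at \<open>\<mu> = 0\<close>. The
  hypothesis on \<open>\<sigma>\<close> makes that summand the plain product of
  \<open>f (\<lambda>a. 0) x\<close> and the coefficient sought.\<close>

lemma twisted_inverse_convolution:
  assumes \<kappa>: "\<kappa> \<in> exponents ds" and nz: "f (\<lambda>a. 0) x \<noteq> 0"
    and \<sigma>: "\<And>\<nu>. \<sigma> (\<lambda>a. 0) \<nu> = 1"
  shows "(\<Sum>\<mu>\<in>{..\<kappa>}. \<sigma> \<mu> (\<kappa> - \<mu>) * f \<mu> x * twisted_inverse (\<kappa> - \<mu>) x) =
    (if \<kappa> = (\<lambda>a. 0) then 1 else 0)"
proof -
  \<comment> \<open>The summands with nonzero \<open>\<mu>\<close>, which involve only coefficients
    of the inverse of smaller total degree.\<close>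
  define S where
    "S = (\<Sum>\<mu>\<in>{..\<kappa>} - {\<lambda>a. 0}. \<sigma> \<mu> (\<kappa> - \<mu>) * f \<mu> x * twisted_inverse (\<kappa> - \<mu>) x)"
  have minus_zero: "\<kappa> - (\<lambda>a. 0) = \<kappa>" by (simp add: fun_diff_def)
  have "(\<Sum>\<mu>\<in>{..\<kappa>}. \<sigma> \<mu> (\<kappa> - \<mu>) * f \<mu> x * twisted_inverse (\<kappa> - \<mu>) x) =
      f (\<lambda>a. 0) x * twisted_inverse \<kappa> x + S"
    unfolding S_def using finite_atMost_exponent[OF \<kappa>]
    by (subst sum.remove[of _ "\<lambda>a. 0"]) (auto simp: le_fun_def minus_zero \<sigma>)
  also have "twisted_inverse \<kappa> x =
      inverse (f (\<lambda>a. 0) x) * ((if \<kappa> = (\<lambda>a. 0) then 1 else 0) - S)"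
    unfolding S_def using \<kappa> by (subst twisted_inverse.simps) (simp add: sum_negf)
  also have "f (\<lambda>a. 0) x * \<dots> + S = (if \<kappa> = (\<lambda>a. 0) then 1 else 0)"
    using nz by (simp add: mult.assoc[symmetric])
  finally show ?thesis .
qed

end

lemma series_right_inverse:
  assumes f: "f \<in> series_set p ds V" and nz: "\<And>x. x \<in> V \<Longrightarrow> f (\<lambda>a. 0) x \<noteq> 0"
  obtains g where "g \<in> series_set p ds V"
    "series_mult ds f g = (\<lambda>\<mu> x. if \<mu> = (\<lambda>a. 0) \<and> x \<in> V then 1 else 0)"
proof
  let ?g = "twisted_inverse ds (exponent_sign ds) f"
  show "?g \<in> series_set p ds V"
    using f nz by (rule twisted_inverse_in_series_set)
  show "series_mult ds f ?g = (\<lambda>\<mu> x. if \<mu> = (\<lambda>a. 0) \<and> x \<in> V then 1 else 0)"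
  proof (intro ext)
    fix \<kappa> :: "nat \<Rightarrow> nat" and x :: "nat \<Rightarrow> real"
    \<comment> \<open>Outside \<open>V\<close> both sides vanish because coefficients are extended
      by zero; the convolution identity is applied inside \<open>V\<close>, where it may divide by
      the zeroth coefficient.\<close>
    have "f \<mu> x = 0" if "x \<notin> V" for \<mu>
      using f that by (cases "\<mu> \<in> exponents ds") (auto simp: series_set_def smooth_functions_def)
    then show "series_mult ds f ?g \<kappa> x = (if \<kappa> = (\<lambda>a. 0) \<and> x \<in> V then 1 else 0)"
      using twisted_inverse_convolution[of \<kappa> ds f x "exponent_sign ds"] nz[of x]
      by (cases "x \<in> V")
        (auto simp: series_mult_def exponent_sign_zero_left exponents_zero)
  qed
qed

text \<open>A left inverse is a right inverse for the opposite multiplication, whose sign has its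
  arguments exchanged.\<close>

lemma series_left_inverse:
  assumes f: "f \<in> series_set p ds V" and nz: "\<And>x. x \<in> V \<Longrightarrow> f (\<lambda>a. 0) x \<noteq> 0"
  obtains g where "g \<in> series_set p ds V"
    "series_mult ds g f = (\<lambda>\<mu> x. if \<mu> = (\<lambda>a. 0) \<and> x \<in> V then 1 else 0)"
proof
  let ?\<sigma> = "\<lambda>\<mu> \<nu>. exponent_sign ds \<nu> \<mu>"
  let ?g = "twisted_inverse ds ?\<sigma> f"
  show "?g \<in> series_set p ds V"
    using f nz by (rule twisted_inverse_in_series_set)
  show "series_mult ds ?g f = (\<lambda>\<mu> x. if \<mu> = (\<lambda>a. 0) \<and> x \<in> V then 1 else 0)"
  proof (intro ext)
    fix \<kappa> :: "nat \<Rightarrow> nat" and x :: "nat \<Rightarrow> real"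
    have f0: "f \<mu> x = 0" if "x \<notin> V" for \<mu>
      using f that by (cases "\<mu> \<in> exponents ds") (auto simp: series_set_def smooth_functions_def)
    \<comment> \<open>Subtraction of natural numbers is truncated, so the reflection used to reindex
      the sum is an involution only below \<open>\<kappa>\<close>.\<close>
    have flip: "\<kappa> - (\<kappa> - \<mu>) = \<mu>" if "\<mu> \<le> \<kappa>" for \<mu>
      using that by (auto simp: fun_eq_iff le_fun_def)
    have "(\<Sum>\<mu>\<in>{..\<kappa>}. exponent_sign ds \<mu> (\<kappa> - \<mu>) * ?g \<mu> x * f (\<kappa> - \<mu>) x) =
        (\<Sum>\<mu>\<in>{..\<kappa>}. ?\<sigma> \<mu> (\<kappa> - \<mu>) * f \<mu> x * ?g (\<kappa> - \<mu>) x)"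
      by (rule sum.reindex_bij_witness[of _ "\<lambda>\<mu>. \<kappa> - \<mu>" "\<lambda>\<mu>. \<kappa> - \<mu>"])
        (auto simp: flip le_fun_def)
    then show "series_mult ds ?g f \<kappa> x = (if \<kappa> = (\<lambda>a. 0) \<and> x \<in> V then 1 else 0)"
      using twisted_inverse_convolution[of \<kappa> ds f x ?\<sigma>] nz[of x]
      by (cases "x \<in> V")
        (auto simp: series_mult_def exponent_sign_zero_right exponents_zero f0)
  qed
qed

text \<open>Only the zero exponent lies below itself, so the sum has one summand, with sign 1. This
  makes evaluation of the zeroth coefficient multiplicative.\<close>

lemma series_mult_zero_exponent:
  "series_mult ds f g (\<lambda>a. 0) x = f (\<lambda>a. 0) x * g (\<lambda>a. 0) x"
  by (simp add: series_mult_def exponents_zero atMost_zero_exponent exponent_sign_zero_left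
      fun_diff_def)

section \<open>Real-valued characters of sections at a point\<close>

lemma graded_hom_component:
  "h \<in> graded_hom n A B \<Longrightarrow> i \<in> Z2n n \<Longrightarrow> x \<in> component A i \<Longrightarrow> h x \<in> component B i"
  unfolding graded_hom_def by blast

context z2n_presheaf
begin

lemma ring_sections: "openin (base_space M) U \<Longrightarrow> ring (sections M U)"
  using sections_algebra z2n_comm_algebra.axioms(1) by blast

lemma module_sections: "openin (base_space M) U \<Longrightarrow> module real_ring (sections M U)"
  using sections_algebra z2n_comm_algebra.axioms(2) by blast

context
  fixes U assumes U: "openin (base_space M) U"
begin

interpretation ring "sections M U" using U by (rule ring_sections)

lemma one_section: "\<one>\<^bsub>sections M U\<^esub> \<in> carrier (sections M U)"
  by simp

lemma add_section: "s \<in> carrier (sections M U) \<Longrightarrow> t \<in> carrier (sections M U) \<Longrightarrow>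
    s \<oplus>\<^bsub>sections M U\<^esub> t \<in> carrier (sections M U)"
  by simp

lemma mult_section: "s \<in> carrier (sections M U) \<Longrightarrow> t \<in> carrier (sections M U) \<Longrightarrow>
    s \<otimes>\<^bsub>sections M U\<^esub> t \<in> carrier (sections M U)"
  by simp

lemma smult_section: "s \<in> carrier (sections M U) \<Longrightarrow> r \<odot>\<^bsub>sections M U\<^esub> s \<in> carrier (sections M U)"
  using module.smult_closed[OF module_sections[OF U], of r s] by (simp add: real_ring_def)

lemma component_section:
  "i \<in> Z2n n \<Longrightarrow> s \<in> component (sections M U) i \<Longrightarrow> s \<in> carrier (sections M U)"
  using z2n_comm_algebra.component_submodule[OF sections_algebra[OF U], of i]
  by (auto simp: submodule_def dest!: subgroup.subset)

end

lemma minus_const_section: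
  assumes U: "openin (base_space M) U" and s: "s \<in> carrier (sections M U)"
  shows "s \<ominus>\<^bsub>sections M U\<^esub> k \<odot>\<^bsub>sections M U\<^esub> \<one>\<^bsub>sections M U\<^esub> \<in> carrier (sections M U)"
proof -
  interpret ring "sections M U" using U by (rule ring_sections)
  show ?thesis using s smult_section[OF U one_closed] by simp
qed

context
  fixes U V assumes UV: "openin (base_space M) U" "openin (base_space M) V" "V \<subseteq> U"
begin

lemma restriction_ring_hom: "restriction M U V \<in> ring_hom (sections M U) (sections M V)"
  using restriction_hom[OF UV] by (simp add: graded_hom_def)

lemmas restriction_closed = ring_hom_closed[OF restriction_ring_hom]
lemmas restriction_mult = ring_hom_mult[OF restriction_ring_hom]
lemmas restriction_add = ring_hom_add[OF restriction_ring_hom]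
lemmas restriction_one = ring_hom_one[OF restriction_ring_hom]

lemma restriction_smult: "s \<in> carrier (sections M U) \<Longrightarrow>
    restriction M U V (r \<odot>\<^bsub>sections M U\<^esub> s) = r \<odot>\<^bsub>sections M V\<^esub> restriction M U V s"
  using restriction_hom[OF UV] by (simp add: graded_hom_def)

lemma restriction_component:
  "i \<in> Z2n n \<Longrightarrow> s \<in> component (sections M U) i \<Longrightarrow> restriction M U V s \<in> component (sections M V) i"
  by (rule graded_hom_component[OF restriction_hom[OF UV]])

end

end

text \<open>Such a compatible family amounts to a unital real algebra morphism from the stalk at
  \<open>m\<close> to the reals. It is expressed on sections, where the ring laws are at hand; its
  values on sets that are not open neighbourhoods of \<open>m\<close> are unconstrained.\<close>

locale point_character = z2n_presheaf n M
  for n :: nat and M :: "('m, 'a) algebraed_space" +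
  fixes m :: 'm and \<theta> :: "'m set \<Rightarrow> 'a \<Rightarrow> real"
  assumes character_add:
      "\<lbrakk>openin (base_space M) U; m \<in> U; s \<in> carrier (sections M U); t \<in> carrier (sections M U)\<rbrakk>
        \<Longrightarrow> \<theta> U (s \<oplus>\<^bsub>sections M U\<^esub> t) = \<theta> U s + \<theta> U t"
    and character_mult:
      "\<lbrakk>openin (base_space M) U; m \<in> U; s \<in> carrier (sections M U); t \<in> carrier (sections M U)\<rbrakk>
        \<Longrightarrow> \<theta> U (s \<otimes>\<^bsub>sections M U\<^esub> t) = \<theta> U s * \<theta> U t"
    and character_one: "\<lbrakk>openin (base_space M) U; m \<in> U\<rbrakk> \<Longrightarrow> \<theta> U \<one>\<^bsub>sections M U\<^esub> = 1"
    and character_smult: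
      "\<lbrakk>openin (base_space M) U; m \<in> U; s \<in> carrier (sections M U)\<rbrakk>
        \<Longrightarrow> \<theta> U (r \<odot>\<^bsub>sections M U\<^esub> s) = r * \<theta> U s"
    and character_restriction:
      "\<lbrakk>openin (base_space M) U; openin (base_space M) V; V \<subseteq> U; m \<in> V; s \<in> carrier (sections M U)\<rbrakk>
        \<Longrightarrow> \<theta> V (restriction M U V s) = \<theta> U s"
begin

lemma character_zero:
  assumes "openin (base_space M) U" "m \<in> U"
  shows "\<theta> U \<zero>\<^bsub>sections M U\<^esub> = 0"
proof -
  interpret ring "sections M U" using assms(1) by (rule ring_sections)
  show ?thesis using character_add[OF assms zero_closed zero_closed] by simp
qed

lemma character_minus_const:
  assumes U: "openin (base_space M) U" "m \<in> U" and s: "s \<in> carrier (sections M U)"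
  shows "\<theta> U (s \<ominus>\<^bsub>sections M U\<^esub> k \<odot>\<^bsub>sections M U\<^esub> \<one>\<^bsub>sections M U\<^esub>) = \<theta> U s - k"
proof -
  interpret ring "sections M U" using U(1) by (rule ring_sections)
  let ?t = "k \<odot>\<^bsub>sections M U\<^esub> \<one>\<^bsub>sections M U\<^esub>"
  have t: "?t \<in> carrier (sections M U)" using smult_section[OF U(1) one_closed] .
  have "\<theta> U (?t \<oplus>\<^bsub>sections M U\<^esub> \<ominus>\<^bsub>sections M U\<^esub> ?t) = 0"
    using t character_zero[OF U] by (simp add: r_neg)
  then have "\<theta> U (\<ominus>\<^bsub>sections M U\<^esub> ?t) = - k"
    using character_add[OF U t a_inv_closed[OF t]] character_smult[OF U one_closed]
      character_one[OF U] by simp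
  then show ?thesis
    using character_add[OF U s a_inv_closed[OF t]] by (simp add: a_minus_def)
qed

lemma character_Units:
  assumes U: "openin (base_space M) U" "m \<in> U" and s: "s \<in> Units (sections M U)"
  shows "\<theta> U s \<noteq> 0"
proof -
  from s obtain t where "s \<in> carrier (sections M U)" "t \<in> carrier (sections M U)"
    "s \<otimes>\<^bsub>sections M U\<^esub> t = \<one>\<^bsub>sections M U\<^esub>"
    by (auto simp: Units_def)
  then have "\<theta> U s * \<theta> U t = 1"
    using character_mult[OF U, of s t] character_one[OF U] by simp
  then show ?thesis by auto
qed

end

text \<open>The properties of evaluation in a chart beyond being a character:
  \<open>locally_unit\<close> makes germs outside the kernel invertible, and
  \<open>component_character\<close> will make the kernel homogeneous.\<close>

locale point_evaluation = point_character +
  assumes locally_unit: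
      "\<lbrakk>openin (base_space M) U; m \<in> U; s \<in> carrier (sections M U); \<theta> U s \<noteq> 0\<rbrakk>
        \<Longrightarrow> \<exists>W. openin (base_space M) W \<and> m \<in> W \<and> W \<subseteq> U \<and>
              restriction M U W s \<in> Units (sections M W)"
    and component_character:
      "\<lbrakk>openin (base_space M) U; m \<in> U; i \<in> Z2n n; i \<noteq> z2_zero n; s \<in> component (sections M U) i\<rbrakk>
        \<Longrightarrow> \<theta> U s = 0"
begin

text \<open>The competitor is an arbitrary character, so the pullback of an evaluation along a
  morphism qualifies.\<close>

lemma character_unique:
  assumes "point_character n M m \<theta>'"
    and U: "openin (base_space M) U" "m \<in> U" and s: "s \<in> carrier (sections M U)"
  shows "\<theta>' U s = \<theta> U s"
proof (rule ccontr)
  interpret other: point_character n M m \<theta>' by fact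
  assume neq: "\<theta>' U s \<noteq> \<theta> U s"
  let ?t = "s \<ominus>\<^bsub>sections M U\<^esub> \<theta>' U s \<odot>\<^bsub>sections M U\<^esub> \<one>\<^bsub>sections M U\<^esub>"
  have t: "?t \<in> carrier (sections M U)" using U(1) s by (rule minus_const_section)
  have "\<theta> U ?t \<noteq> 0"
    using neq by (simp add: character_minus_const[OF U s])
  then obtain W where W: "openin (base_space M) W" "m \<in> W" "W \<subseteq> U"
    and unit: "restriction M U W ?t \<in> Units (sections M W)"
    using locally_unit[OF U t] by blast
  have "\<theta>' W (restriction M U W ?t) = 0"
    using other.character_restriction[OF U(1) W(1,3,2) t] other.character_minus_const[OF U s] by simp
  then show False using other.character_Units[OF W(1,2) unit] by simp
qed

text \<open>Subtracting \<open>k\<close> from \<open>s\<close> leaves the value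
  \<open>\<theta> U s - k\<close>. If this is zero, no restriction to a neighbourhood of
  \<open>m\<close> is a unit; otherwise some restriction is one by \<open>locally_unit\<close>. So
  exactly one \<open>k\<close> meets the description.\<close>

lemma base_projection_eq:
  assumes U: "openin (base_space M) U" "m \<in> U" and s: "s \<in> carrier (sections M U)"
  shows "base_projection M U s m = \<theta> U s"
  unfolding base_projection_def
proof (rule the_equality, intro allI impI notI)
  fix W
  let ?t = "s \<ominus>\<^bsub>sections M U\<^esub> \<theta> U s \<odot>\<^bsub>sections M U\<^esub> \<one>\<^bsub>sections M U\<^esub>"
  assume W: "openin (base_space M) W \<and> m \<in> W \<and> W \<subseteq> U"
    and unit: "restriction M U W ?t \<in> Units (sections M W)"
  have "\<theta> W (restriction M U W ?t) = 0"
    using W character_restriction[OF U(1) _ _ _ minus_const_section[OF U(1) s], of W]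
      character_minus_const[OF U s] by simp
  then show False using character_Units[OF _ _ unit] W by simp
next
  fix k
  let ?t = "s \<ominus>\<^bsub>sections M U\<^esub> k \<odot>\<^bsub>sections M U\<^esub> \<one>\<^bsub>sections M U\<^esub>"
  assume k: "\<forall>W. openin (base_space M) W \<and> m \<in> W \<and> W \<subseteq> U \<longrightarrow>
    restriction M U W ?t \<notin> Units (sections M W)"
  then have "\<theta> U ?t = 0"
    using locally_unit[OF U minus_const_section[OF U(1) s]] by blast
  then show "k = \<theta> U s" by (simp add: character_minus_const[OF U s])
qed

end

section \<open>Pullback of sections and characters along a morphism\<close>

context z2n_morphism
begin

lemma openin_preimage:
  "openin (base_space N) V \<Longrightarrow> openin (base_space M) (preimage M \<psi> V)"
  using continuous by (simp add: preimage_def continuous_map)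

lemma preimage_mono: "V \<subseteq> W \<Longrightarrow> preimage M \<psi> V \<subseteq> preimage M \<psi> W"
  by (auto simp: preimage_def)

lemma pullback_ring_hom:
  "openin (base_space N) V \<Longrightarrow> \<psi>s V \<in> ring_hom (sections N V) (sections M (preimage M \<psi> V))"
  using pullback_hom by (simp add: graded_hom_def)

lemmas pullback_closed = ring_hom_closed[OF pullback_ring_hom]
lemmas pullback_mult = ring_hom_mult[OF pullback_ring_hom]
lemmas pullback_add = ring_hom_add[OF pullback_ring_hom]
lemmas pullback_one = ring_hom_one[OF pullback_ring_hom]

lemma pullback_smult: "openin (base_space N) V \<Longrightarrow> s \<in> carrier (sections N V) \<Longrightarrow>
    \<psi>s V (r \<odot>\<^bsub>sections N V\<^esub> s) = r \<odot>\<^bsub>sections M (preimage M \<psi> V)\<^esub> \<psi>s V s"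
  using pullback_hom by (simp add: graded_hom_def)

lemma pullback_component: "openin (base_space N) V \<Longrightarrow> i \<in> Z2n n \<Longrightarrow> s \<in> component (sections N V) i \<Longrightarrow>
    \<psi>s V s \<in> component (sections M (preimage M \<psi> V)) i"
  by (rule graded_hom_component[OF pullback_hom])

text \<open>Composing a character with algebra morphisms gives a character; compatibility with
  restriction is the naturality of the pullback. As \<open>preimage\<close> is cut down to the space
  of \<open>M\<close>, \<open>m\<close> must belong to that space.\<close>

lemma pullback_character:
  assumes "point_character n M m \<theta>" "z2n_presheaf n N" and m: "m \<in> topspace (base_space M)"
  shows "point_character n N (\<psi> m) (\<lambda>V t. \<theta> (preimage M \<psi> V) (\<psi>s V t))"
proof -
  interpret point_character n M m \<theta> by fact
  interpret N: z2n_presheaf n N by fact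
  have mem: "m \<in> preimage M \<psi> V" if "\<psi> m \<in> V" for V
    using m that by (simp add: preimage_def)
  show ?thesis
  proof unfold_locales
    fix U V s assume "openin (base_space N) U" "openin (base_space N) V" "V \<subseteq> U" "\<psi> m \<in> V"
      "s \<in> carrier (sections N U)"
    then show "\<theta> (preimage M \<psi> V) (\<psi>s V (restriction N U V s)) = \<theta> (preimage M \<psi> U) (\<psi>s U s)"
      by (simp add: pullback_restriction character_restriction openin_preimage preimage_mono mem
          pullback_closed)
  qed (simp_all add: mem openin_preimage pullback_closed pullback_mult pullback_add pullback_one
      pullback_smult character_add character_mult character_one character_smult)
qed

end

section \<open>Evaluation in a chart\<close>

text \<open>Associativity identifies the two inverses. This is applied in the ring of sections of
  \<open>M\<close>, to which left and right inverses of series are carried separately.\<close>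

lemma (in monoid) left_right_inverse_Units:
  assumes "x \<in> carrier G" "y \<in> carrier G" "z \<in> carrier G" "x \<otimes> y = \<one>" "z \<otimes> x = \<one>"
  shows "x \<in> Units G"
  using assms inv_unique[of z x y] by (auto simp: Units_def)

text \<open>Translate the section into a series by \<open>\<phi>s\<close>, shrink to where its
  zeroth coefficient has no zeros, invert there, and carry the inverses back by
  \<open>\<psi>s\<close>.\<close>

lemma superdomain_chart_locally_unit:
  fixes M :: "('m, 'a) algebraed_space"
  assumes M: "z2n_presheaf n M" and U0: "openin (base_space M) U0" and V0: "openin (Euclidean_space p) V0"
    and f: "z2n_morphism n (restrict_space_to M U0) (superdomain n p ds V0) \<psi> \<psi>s"
    and g: "z2n_morphism n (superdomain n p ds V0) (restrict_space_to M U0) \<phi> \<phi>s"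
    and \<phi>\<psi>: "\<And>x. x \<in> U0 \<Longrightarrow> \<phi> (\<psi> x) = x"
    and \<psi>\<phi>: "\<And>y. y \<in> V0 \<Longrightarrow> \<psi> (\<phi> y) = y"
    and \<psi>s\<phi>s: "\<And>W s. openin (base_space M) W \<Longrightarrow> W \<subseteq> U0 \<Longrightarrow> s \<in> carrier (sections M W) \<Longrightarrow>
      \<psi>s (preimage (superdomain n p ds V0) \<phi> W) (\<phi>s W s) = s"
    and W: "openin (base_space M) W" "W \<subseteq> U0" "m \<in> W"
    and t: "t \<in> carrier (sections M W)" and nz: "\<phi>s W t (\<lambda>a. 0) (\<psi> m) \<noteq> 0"
  shows "\<exists>W'. openin (base_space M) W' \<and> m \<in> W' \<and> W' \<subseteq> W \<and>
    restriction M W W' t \<in> Units (sections M W')"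
proof -
  let ?D = "superdomain n p ds V0" and ?M = "restrict_space_to M U0"
  interpret z2n_presheaf n M by fact
  interpret f: z2n_morphism n ?M ?D \<psi> \<psi>s by fact
  interpret g: z2n_morphism n ?D ?M \<phi> \<phi>s by fact
  have topM: "topspace (base_space ?M) = U0"
    using openin_subset[OF U0] by (auto simp: restrict_space_to_def)
  have topD: "topspace (base_space ?D) = V0"
    using openin_subset[OF V0] by (auto simp: superdomain_def)
  have openM: "openin (base_space ?M) S \<longleftrightarrow> openin (base_space M) S \<and> S \<subseteq> U0" for S
    by (simp add: restrict_space_to_def openin_open_subtopology[OF U0])
  have openD: "openin (base_space ?D) S \<longleftrightarrow> openin (Euclidean_space p) S \<and> S \<subseteq> V0" for S
    by (simp add: superdomain_def openin_open_subtopology[OF V0])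
  have secM: "sections ?M = sections M" and resM: "restriction ?M = restriction M"
    by (simp_all add: restrict_space_to_def)
  have secD: "sections ?D = series_algebra n p ds"
    by (simp add: superdomain_def)
  have \<psi>: "\<psi> y \<in> V0" if "y \<in> U0" for y
    using continuous_map_image_subset_topspace[OF f.continuous] that by (auto simp: topM topD)
  have \<phi>: "\<phi> y \<in> U0" if "y \<in> V0" for y
    using continuous_map_image_subset_topspace[OF g.continuous] that by (auto simp: topM topD)
  let ?W = "preimage ?D \<phi> W" and ?F = "\<phi>s W t"
  have openW: "openin (base_space ?M) W" using W by (simp add: openM)
  have "?F \<in> series_set p ds ?W"
    using g.pullback_closed[OF openW] t by (simp add: secM secD series_algebra_def)
  then have "Ck p 0 ?W (?F (\<lambda>a. 0))"
    using exponents_zero unfolding series_set_def smooth_functions_def by blast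
  then have cont: "continuous_map (subtopology (Euclidean_space p) ?W) euclideanreal (?F (\<lambda>a. 0))"
    by simp
  \<comment> \<open>Open by continuity of the zeroth coefficient, which is the instance
    \<open>Ck p 0\<close> of smoothness.\<close>
  define P where "P = {y \<in> ?W. ?F (\<lambda>a. 0) y \<noteq> 0}"
  have W'open: "openin (Euclidean_space p) ?W" and W'V0: "?W \<subseteq> V0"
    using g.openin_preimage[OF openW] by (simp_all add: openD)
  have topW': "topspace (subtopology (Euclidean_space p) ?W) = ?W"
    using openin_subset[OF W'open] by auto
  have "openin (subtopology (Euclidean_space p) ?W) P"
    using openin_continuous_map_preimage[OF cont, of "- {0}"]
    by (simp add: P_def topW' open_Compl del: topspace_subtopology)
  then have P: "openin (base_space ?D) P"
    using W'V0 by (auto simp: openD openin_open_subtopology[OF W'open])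
  define W2 where "W2 = preimage ?M \<psi> P"
  have "openin (base_space ?M) W2" unfolding W2_def by (rule f.openin_preimage[OF P])
  then have W2: "openin (base_space M) W2" "W2 \<subseteq> U0" by (simp_all add: openM)
  have mW2: "m \<in> W2"
    using W nz \<psi>[of m] \<phi>\<psi>[of m] by (auto simp: W2_def preimage_def P_def topM topD)
  have W2W: "W2 \<subseteq> W"
    using \<phi>\<psi> by (auto simp: W2_def preimage_def P_def topM topD)
  \<comment> \<open>The chart matches \<open>W2\<close> with \<open>P\<close> exactly, so
    \<open>\<phi>s W2\<close> leads to series over \<open>P\<close> and \<open>\<psi>s P\<close>
    leads back to sections over \<open>W2\<close>.\<close>
  have pre: "preimage ?D \<phi> W2 = P"
    using \<psi>\<phi> \<phi> W'V0 by (auto simp: W2_def preimage_def P_def topM topD)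
  have openW2: "openin (base_space ?M) W2" using W2 by (simp add: openM)
  define t2 where "t2 = restriction M W W2 t"
  have t2: "t2 \<in> carrier (sections M W2)"
    unfolding t2_def using restriction_closed[OF W(1) W2(1) W2W t] .
  have F2: "\<phi>s W2 t2 \<in> series_set p ds P"
    using g.pullback_closed[OF openW2] t2 by (simp add: secM secD series_algebra_def pre)
  \<comment> \<open>The pullback commutes with restriction, and restriction of series keeps the
    values of coefficients on the smaller set.\<close>
  have F2_nz: "\<phi>s W2 t2 (\<lambda>a. 0) y \<noteq> 0" if "y \<in> P" for y
  proof -
    have "restriction ?D ?W P ?F (\<lambda>a. 0) y = ?F (\<lambda>a. 0) y"
      using that by (simp add: superdomain_def)
    moreover have "?F (\<lambda>a. 0) y \<noteq> 0" using that by (simp add: P_def)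
    ultimately show ?thesis
      using g.pullback_restriction[OF openW openW2 W2W] t by (simp add: secM resM t2_def pre)
  qed
  obtain G where G: "G \<in> series_set p ds P"
      "series_mult ds (\<phi>s W2 t2) G = (\<lambda>\<mu> x. if \<mu> = (\<lambda>a. 0) \<and> x \<in> P then 1 else 0)"
    using F2 F2_nz by (rule series_right_inverse)
  obtain H where H: "H \<in> series_set p ds P"
      "series_mult ds H (\<phi>s W2 t2) = (\<lambda>\<mu> x. if \<mu> = (\<lambda>a. 0) \<and> x \<in> P then 1 else 0)"
    using F2 F2_nz by (rule series_left_inverse)
  have t2_eq: "\<psi>s P (\<phi>s W2 t2) = t2"
    using \<psi>s\<phi>s[OF W2 t2] by (simp add: pre)
  have hom: "\<psi>s P \<in> ring_hom (series_algebra n p ds P) (sections M W2)"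
    using f.pullback_ring_hom[OF P] by (simp add: secM secD W2_def)
  interpret R: ring "sections M W2" using W2(1) by (rule ring_sections)
  have "t2 \<in> Units (sections M W2)"
  proof (rule R.left_right_inverse_Units)
    show "\<psi>s P G \<in> carrier (sections M W2)" "\<psi>s P H \<in> carrier (sections M W2)"
      using ring_hom_closed[OF hom] G H by (simp_all add: series_algebra_def)
    show "t2 \<otimes>\<^bsub>sections M W2\<^esub> \<psi>s P G = \<one>\<^bsub>sections M W2\<^esub>"
      using ring_hom_mult[OF hom, of "\<phi>s W2 t2" G] ring_hom_one[OF hom] F2 G
      by (simp add: series_algebra_def t2_eq)
    show "\<psi>s P H \<otimes>\<^bsub>sections M W2\<^esub> t2 = \<one>\<^bsub>sections M W2\<^esub>"
      using ring_hom_mult[OF hom, of H "\<phi>s W2 t2"] ring_hom_one[OF hom] F2 H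
      by (simp add: series_algebra_def t2_eq)
  qed (rule t2)
  then show ?thesis
    using W2(1) mW2 W2W unfolding t2_def by blast
qed

text \<open>A section over any neighbourhood of \<open>m\<close> is first restricted to the chart
  domain \<open>U0\<close> and then evaluated through its series.\<close>

lemma (in z2n_supermanifold) ex_point_evaluation:
  assumes m: "m \<in> topspace (base_space M)"
  shows "\<exists>\<theta>. point_evaluation n M m \<theta>"
proof -
  obtain U0 V0 ds where U0: "openin (base_space M) U0" "m \<in> U0"
    and V0: "openin (Euclidean_space p) V0"
    and iso: "z2n_isomorphic n (restrict_space_to M U0) (superdomain n p ds V0)"
    using local_charts[OF m] by blast
  let ?D = "superdomain n p ds V0" and ?M = "restrict_space_to M U0"
  have topM: "topspace (base_space ?M) = U0"
    using openin_subset[OF U0(1)] by (auto simp: restrict_space_to_def)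
  have topD: "topspace (base_space ?D) = V0"
    using openin_subset[OF V0] by (auto simp: superdomain_def)
  have openM: "openin (base_space ?M) S \<longleftrightarrow> openin (base_space M) S \<and> S \<subseteq> U0" for S
    by (simp add: restrict_space_to_def openin_open_subtopology[OF U0(1)])
  have secM: "sections ?M = sections M" and resM: "restriction ?M = restriction M"
    by (simp_all add: restrict_space_to_def)
  from iso obtain \<psi> \<psi>s \<phi> \<phi>s where
    f: "z2n_morphism n ?M ?D \<psi> \<psi>s" and g: "z2n_morphism n ?D ?M \<phi> \<phi>s" and
    \<phi>\<psi>: "\<And>x. x \<in> U0 \<Longrightarrow> \<phi> (\<psi> x) = x" and
    \<psi>\<phi>: "\<And>y. y \<in> V0 \<Longrightarrow> \<psi> (\<phi> y) = y" and
    \<psi>s\<phi>s: "\<And>W s. openin (base_space M) W \<Longrightarrow> W \<subseteq> U0 \<Longrightarrow> s \<in> carrier (sections M W) \<Longrightarrow>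
      \<psi>s (preimage ?D \<phi> W) (\<phi>s W s) = s"
    unfolding z2n_isomorphic_def topM topD openM secM by metis
  interpret f: z2n_morphism n ?M ?D \<psi> \<psi>s by fact
  interpret g: z2n_morphism n ?D ?M \<phi> \<phi>s by fact
  have x: "\<psi> m \<in> V0"
    using continuous_map_image_subset_topspace[OF f.continuous] U0 by (auto simp: topM topD)
  define e where "e W t = \<phi>s W t (\<lambda>a. 0) (\<psi> m)" for W t
  have secD: "sections ?D = series_algebra n p ds"
    by (simp add: superdomain_def)
  \<comment> \<open>Series are zero outside their domain. That \<open>\<psi> m\<close> lies inside
    is what gives the unit the value 1 and makes the value survive restriction.\<close>
  have mem: "\<psi> m \<in> preimage ?D \<phi> W" if "m \<in> W" for W
    using that x U0 \<phi>\<psi> by (simp add: preimage_def topD)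
  note hom = g.pullback_add g.pullback_mult g.pullback_one g.pullback_smult
  have e_add: "e W (s \<oplus>\<^bsub>sections M W\<^esub> t) = e W s + e W t"
    and e_mult: "e W (s \<otimes>\<^bsub>sections M W\<^esub> t) = e W s * e W t"
    if "openin (base_space M) W" "W \<subseteq> U0" "s \<in> carrier (sections M W)" "t \<in> carrier (sections M W)"
    for W s t
    using that hom(1,2)[of W s t]
    by (simp_all add: openM secM secD e_def series_algebra_def series_mult_zero_exponent)
  have e_smult: "e W (r \<odot>\<^bsub>sections M W\<^esub> s) = r * e W s"
    if "openin (base_space M) W" "W \<subseteq> U0" "s \<in> carrier (sections M W)" for W r s
    using that hom(4)[of W s r] by (simp add: openM secM secD e_def series_algebra_def)
  have e_one: "e W \<one>\<^bsub>sections M W\<^esub> = 1" if "openin (base_space M) W" "W \<subseteq> U0" "m \<in> W" for W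
    using that hom(3)[of W] mem[of W] by (simp add: openM secM secD e_def series_algebra_def)
  have e_component: "e W s = 0"
    if "openin (base_space M) W" "W \<subseteq> U0" "i \<in> Z2n n" "i \<noteq> z2_zero n" "s \<in> component (sections M W) i"
    for W i s
  proof -
    have "\<phi>s W s \<in> component (series_algebra n p ds (preimage ?D \<phi> W)) i"
      using that g.pullback_component[of W i s] by (simp add: openM secM secD)
    \<comment> \<open>The zero exponent has degree zero, so a series homogeneous of another degree
      has no zeroth coefficient.\<close>
    then have "\<phi>s W s (\<lambda>a. 0) = (\<lambda>x. 0)"
      using that(4) exponents_zero[of ds] by (simp add: series_algebra_def exponent_degree_zero)
    then show ?thesis by (simp add: e_def)
  qed
  have e_res: "e V (restriction M W V s) = e W s"
    if "openin (base_space M) W" "openin (base_space M) V" "V \<subseteq> W" "W \<subseteq> U0" "m \<in> V"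
      "s \<in> carrier (sections M W)" for V W s
    using that g.pullback_restriction[of W V s] mem[of V]
    by (simp add: openM secM resM e_def) (simp add: superdomain_def)
  have open_Int: "openin (base_space M) (W \<inter> U0)" if "openin (base_space M) W" for W
    using that U0(1) by (rule openin_Int)
  note res = restriction_closed[OF _ open_Int Int_lower1]
  have "point_evaluation n M m (\<lambda>U s. e (U \<inter> U0) (restriction M U (U \<inter> U0) s))"
  proof unfold_locales
    fix U V s assume V: "openin (base_space M) U" "openin (base_space M) V" "V \<subseteq> U" "m \<in> V"
      and s: "s \<in> carrier (sections M U)"
    have sub: "V \<inter> U0 \<subseteq> U \<inter> U0" using V(3) by blast
    \<comment> \<open>Both sides are the restriction of \<open>s\<close> to
      \<open>V \<inter> U0\<close>, taken through \<open>V\<close> and through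
      \<open>U \<inter> U0\<close>.\<close>
    have "restriction M V (V \<inter> U0) (restriction M U V s) =
        restriction M (U \<inter> U0) (V \<inter> U0) (restriction M U (U \<inter> U0) s)"
      using restriction_comp[OF V(1,2) open_Int[OF V(2)] Int_lower1 V(3) s]
        restriction_comp[OF V(1) open_Int[OF V(1)] open_Int[OF V(2)] sub Int_lower1 s] by simp
    then show "e (V \<inter> U0) (restriction M V (V \<inter> U0) (restriction M U V s)) =
        e (U \<inter> U0) (restriction M U (U \<inter> U0) s)"
      using e_res[OF open_Int[OF V(1)] open_Int[OF V(2)] sub] V U0(2) s by (simp add: res)
  next
    fix U s assume U: "openin (base_space M) U" "m \<in> U" "s \<in> carrier (sections M U)"
      and nz: "e (U \<inter> U0) (restriction M U (U \<inter> U0) s) \<noteq> 0"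
    have "\<exists>W. openin (base_space M) W \<and> m \<in> W \<and> W \<subseteq> U \<inter> U0 \<and>
      restriction M (U \<inter> U0) W (restriction M U (U \<inter> U0) s) \<in> Units (sections M W)"
      by (rule superdomain_chart_locally_unit[of n M U0 p V0 ds \<psi> \<psi>s \<phi> \<phi>s "U \<inter> U0" m
            "restriction M U (U \<inter> U0) s"])
        (fact z2n_presheaf_axioms U0(1) V0 f g \<phi>\<psi> \<psi>\<phi> \<psi>s\<phi>s open_Int[OF U(1)] Int_lower2
          IntI[OF U(2) U0(2)] res[OF U(1) U(1,3)] nz[unfolded e_def])+
    then obtain W where W: "openin (base_space M) W" "m \<in> W" "W \<subseteq> U \<inter> U0"
      "restriction M (U \<inter> U0) W (restriction M U (U \<inter> U0) s) \<in> Units (sections M W)"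
      by blast
    then show "\<exists>W. openin (base_space M) W \<and> m \<in> W \<and> W \<subseteq> U \<and>
        restriction M U W s \<in> Units (sections M W)"
      using restriction_comp[OF U(1) open_Int[OF U(1)] W(1,3) Int_lower1 U(3)] by auto
  next
    fix U i s assume U: "openin (base_space M) U" "m \<in> U" "i \<in> Z2n n" "i \<noteq> z2_zero n"
      "s \<in> component (sections M U) i"
    then show "e (U \<inter> U0) (restriction M U (U \<inter> U0) s) = 0"
      using restriction_component[OF U(1) open_Int[OF U(1)] Int_lower1 U(3,5)]
      by (intro e_component) (auto simp: open_Int)
  qed (simp_all add: restriction_add restriction_mult restriction_one restriction_smult
      open_Int res e_add e_mult e_one e_smult U0)
  then show ?thesis by blast
qed

section \<open>Germs and the maximal ideal of a stalk\<close>

context z2n_presheaf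
begin

lemma germ_self:
  "openin (base_space M) U \<Longrightarrow> m \<in> U \<Longrightarrow> s \<in> carrier (sections M U) \<Longrightarrow> (U, s) \<in> germ M m U s"
  by (auto simp: germ_def)

lemma germ_sym:
  assumes "(V, t) \<in> germ M m U s" "openin (base_space M) U" "m \<in> U" "s \<in> carrier (sections M U)"
  shows "(U, s) \<in> germ M m V t"
proof -
  obtain W where "openin (base_space M) W" "m \<in> W" "W \<subseteq> V \<inter> U"
    "restriction M V W t = restriction M U W s"
    using assms(1) by (auto simp: germ_def Int_commute)
  then show ?thesis using assms unfolding germ_def by blast
qed

text \<open>The two equalities hold simultaneously on the intersection of the neighbourhoods that
  witness them.\<close>

lemma germ_trans:
  assumes VU: "(V, t) \<in> germ M m U s" and XV: "(X, r) \<in> germ M m V t"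
    and U: "openin (base_space M) U" "s \<in> carrier (sections M U)"
  shows "(X, r) \<in> germ M m U s"
proof -
  obtain W where W: "openin (base_space M) W" "m \<in> W" "W \<subseteq> U \<inter> V"
    and eqW: "restriction M U W s = restriction M V W t"
    and V: "openin (base_space M) V" "t \<in> carrier (sections M V)"
    using VU by (auto simp: germ_def)
  obtain W' where W': "openin (base_space M) W'" "m \<in> W'" "W' \<subseteq> V \<inter> X"
    and eqW': "restriction M V W' t = restriction M X W' r"
    and X: "openin (base_space M) X" "m \<in> X" "r \<in> carrier (sections M X)"
    using XV by (auto simp: germ_def)
  have open_Int: "openin (base_space M) (W \<inter> W')"
    using W(1) W'(1) by (rule openin_Int)
  have comp: "restriction M A (W \<inter> W') a = restriction M B (W \<inter> W') (restriction M A B a)"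
    if "openin (base_space M) A" "openin (base_space M) B" "B \<subseteq> A" "W \<inter> W' \<subseteq> B"
      "a \<in> carrier (sections M A)" for A B a
    using restriction_comp[OF that(1,2) open_Int that(4,3,5)] by simp
  have "restriction M U (W \<inter> W') s = restriction M V (W \<inter> W') t"
    using comp[OF U(1) W(1) _ _ U(2)] comp[OF V(1) W(1) _ _ V(2)] W eqW by simp
  also have "\<dots> = restriction M X (W \<inter> W') r"
    using comp[OF V(1) W'(1) _ _ V(2)] comp[OF X(1) W'(1) _ _ X(3)] W' eqW' by simp
  finally show ?thesis
    using X open_Int W W' unfolding germ_def by blast
qed

lemma germ_eq:
  assumes "(V, t) \<in> germ M m U s" "openin (base_space M) U" "m \<in> U" "s \<in> carrier (sections M U)"
  shows "germ M m V t = germ M m U s"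
proof -
  have "openin (base_space M) V" "t \<in> carrier (sections M V)"
    using assms(1) by (auto simp: germ_def)
  then show ?thesis
    using germ_trans[OF assms(1) _ assms(2,4)] germ_trans[OF germ_sym[OF assms]] by auto
qed

lemma stalk_carrierE:
  assumes "X \<in> carrier (stalk M m)"
  obtains U s where "openin (base_space M) U" "m \<in> U" "s \<in> carrier (sections M U)"
    "X = germ M m U s" "(U, s) \<in> X"
  using assms germ_self by (force simp: stalk_def)

lemma stalk_carrier_mem:
  assumes "X \<in> carrier (stalk M m)" "(U, s) \<in> X"
  shows "openin (base_space M) U" "m \<in> U" "s \<in> carrier (sections M U)" "X = germ M m U s"
proof -
  obtain V t where V: "openin (base_space M) V" "m \<in> V" "t \<in> carrier (sections M V)"
    "X = germ M m V t"
    using assms(1) by (rule stalk_carrierE)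
  show "openin (base_space M) U" "m \<in> U" "s \<in> carrier (sections M U)"
    using assms(2) V(4) by (auto simp: germ_def)
  show "X = germ M m U s" using germ_eq[OF _ V(1-3)] assms(2) V(4) by simp
qed

text \<open>Germs are equivalence classes, so equality in the stalk can be proved by exhibiting one
  common representative.\<close>

lemma stalk_carrier_eqI:
  assumes "X \<in> carrier (stalk M m)" "Y \<in> carrier (stalk M m)" "u \<in> X" "u \<in> Y"
  shows "X = Y"
proof -
  obtain U s where u: "u = (U, s)" by (cases u)
  show ?thesis
    using stalk_carrier_mem(4)[OF assms(1), of U s] stalk_carrier_mem(4)[OF assms(2), of U s] assms(3,4)
    by (simp add: u)
qed

lemma stalk_component_carrier:
  "i \<in> Z2n n \<Longrightarrow> X \<in> component (stalk M m) i \<Longrightarrow> X \<in> carrier (stalk M m)"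
  unfolding stalk_def by (auto dest: component_section)

lemma germ_op2E:
  assumes "u \<in> germ_op2 M m f X Y"
  obtains U s V t where "(U, s) \<in> X" "(V, t) \<in> Y"
    "u \<in> germ M m (U \<inter> V)
      (f (sections M (U \<inter> V)) (restriction M U (U \<inter> V) s) (restriction M V (U \<inter> V) t))"
  using assms unfolding germ_op2_def by blast

end

lemma finite_Z2n: "finite (Z2n n)"
proof -
  have "UNIV = {0, 1 :: bit}" by auto
  then have "finite (UNIV :: bit set)" by (metis finite.emptyI finite.insertI)
  then show ?thesis
    using finite_lists_length_eq[of "UNIV :: bit set" n] by (simp add: Z2n_def)
qed

lemma zero_in_Z2n: "z2_zero n \<in> Z2n n"
  by (simp add: Z2n_def z2_zero_def)

section \<open>Values of germs under a character\<close>

context point_character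
begin

lemma character_germ:
  assumes "(V, t) \<in> germ M m U s" "openin (base_space M) U" "s \<in> carrier (sections M U)"
  shows "\<theta> V t = \<theta> U s"
proof -
  obtain W where W: "openin (base_space M) W" "m \<in> W" "W \<subseteq> U" "W \<subseteq> V"
    and eq: "restriction M U W s = restriction M V W t"
    and V: "openin (base_space M) V" "t \<in> carrier (sections M V)"
    using assms(1) by (auto simp: germ_def)
  show ?thesis
    using character_restriction[OF assms(2) W(1,3,2) assms(3)]
      character_restriction[OF V(1) W(1,4,2) V(2)] eq by simp
qed

text \<open>The character as a function on the stalk. The choice of representative is immaterial
  there by \<open>character_germ\<close>.\<close>

definition germ_value :: "('m set \<times> 'a) set \<Rightarrow> real" where
  "germ_value X = (case SOME u. u \<in> X of (U, s) \<Rightarrow> \<theta> U s)"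

lemma germ_value_eq:
  assumes X: "X \<in> carrier (stalk M m)" and mem: "(U, s) \<in> X"
  shows "germ_value X = \<theta> U s"
proof -
  obtain V t where some: "(SOME u. u \<in> X) = (V, t)" by (cases "SOME u. u \<in> X")
  have "(V, t) \<in> X"
    using someI[of "\<lambda>u. u \<in> X", OF mem] by (simp add: some)
  then have "\<theta> V t = \<theta> U s"
    using character_germ stalk_carrier_mem[OF X mem] by simp
  then show ?thesis by (simp add: germ_value_def some)
qed

text \<open>Covers sums and products of germs at once. The hypothesis that the result is a germ,
  later supplied by the ring laws of the stalk, provides a representative of it; this lies in one of
  the germs whose union defines the operation, and its value can be read off there.\<close>

lemma germ_value_op2:
  assumes XY: "X \<in> carrier (stalk M m)" "Y \<in> carrier (stalk M m)" "germ_op2 M m f X Y \<in> carrier (stalk M m)"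
    and closed: "\<And>U s t. openin (base_space M) U \<Longrightarrow> s \<in> carrier (sections M U) \<Longrightarrow>
        t \<in> carrier (sections M U) \<Longrightarrow> f (sections M U) s t \<in> carrier (sections M U)"
    and hom: "\<And>U s t. openin (base_space M) U \<Longrightarrow> m \<in> U \<Longrightarrow> s \<in> carrier (sections M U) \<Longrightarrow>
        t \<in> carrier (sections M U) \<Longrightarrow> \<theta> U (f (sections M U) s t) = g (\<theta> U s) (\<theta> U t)"
  shows "germ_value (germ_op2 M m f X Y) = g (germ_value X) (germ_value Y)"
proof -
  obtain Z z where Z: "(Z, z) \<in> germ_op2 M m f X Y"
    using XY(3) by (rule stalk_carrierE)
  then obtain U s V t where s: "(U, s) \<in> X" and t: "(V, t) \<in> Y"
    and z: "(Z, z) \<in> germ M m (U \<inter> V)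
      (f (sections M (U \<inter> V)) (restriction M U (U \<inter> V) s) (restriction M V (U \<inter> V) t))"
    by (rule germ_op2E)
  note U = stalk_carrier_mem[OF XY(1) s] and V = stalk_carrier_mem[OF XY(2) t]
  have UV: "openin (base_space M) (U \<inter> V)" "m \<in> U \<inter> V"
    using U V by auto
  note rs = restriction_closed[OF U(1) UV(1) Int_lower1 U(3)]
    and rt = restriction_closed[OF V(1) UV(1) Int_lower2 V(3)]
  have "\<theta> Z z = g (\<theta> (U \<inter> V) (restriction M U (U \<inter> V) s)) (\<theta> (U \<inter> V) (restriction M V (U \<inter> V) t))"
    using character_germ[OF z UV(1) closed[OF UV(1) rs rt]] hom[OF UV rs rt] by simp
  also have "\<dots> = g (\<theta> U s) (\<theta> V t)"
    using character_restriction[OF U(1) UV(1) Int_lower1 UV(2) U(3)]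
      character_restriction[OF V(1) UV(1) Int_lower2 UV(2) V(3)] by simp
  finally show ?thesis
    using germ_value_eq[OF XY(1) s] germ_value_eq[OF XY(2) t] germ_value_eq[OF XY(3) Z] by simp
qed

context
  assumes ring: "ring (stalk M m)" and m: "m \<in> topspace (base_space M)"
begin

interpretation R: ring "stalk M m" by (rule ring)

lemma germ_value_add:
  assumes "X \<in> carrier (stalk M m)" "Y \<in> carrier (stalk M m)"
  shows "germ_value (X \<oplus>\<^bsub>stalk M m\<^esub> Y) = germ_value X + germ_value Y"
  using germ_value_op2[OF assms, of add "(+)"] R.a_closed[OF assms]
  by (simp add: stalk_def add_section character_add)

lemma germ_value_mult:
  assumes "X \<in> carrier (stalk M m)" "Y \<in> carrier (stalk M m)"
  shows "germ_value (X \<otimes>\<^bsub>stalk M m\<^esub> Y) = germ_value X * germ_value Y"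
  using germ_value_op2[OF assms, of monoid.mult "(*)"] R.m_closed[OF assms]
  by (simp add: stalk_def mult_section character_mult)

lemma germ_value_one: "germ_value \<one>\<^bsub>stalk M m\<^esub> = 1"
proof -
  let ?T = "topspace (base_space M)"
  have "(?T, \<one>\<^bsub>sections M ?T\<^esub>) \<in> \<one>\<^bsub>stalk M m\<^esub>"
    using germ_self[OF _ m one_section] by (simp add: stalk_def)
  then show ?thesis
    using germ_value_eq[OF R.one_closed] m by (simp add: character_one)
qed

lemma germ_value_zero: "germ_value \<zero>\<^bsub>stalk M m\<^esub> = 0"
  using germ_value_add[OF R.zero_closed R.zero_closed] by simp

lemma germ_value_finsum:
  assumes "finite F" "c \<in> F \<rightarrow> carrier (stalk M m)"
  shows "germ_value (finsum (stalk M m) c F) = (\<Sum>i\<in>F. germ_value (c i))"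
  using assms
proof (induction F)
  case (insert i F)
  then have "c i \<in> carrier (stalk M m)" "c \<in> F \<rightarrow> carrier (stalk M m)" by auto
  then show ?case using insert by (simp add: germ_value_add)
qed (simp add: germ_value_zero)

lemma ideal_germ_value_zero: "ideal {X \<in> carrier (stalk M m). germ_value X = 0} (stalk M m)"
proof (rule idealI[OF ring])
  show "subgroup {X \<in> carrier (stalk M m). germ_value X = 0} (add_monoid (stalk M m))"
  proof (rule group.subgroupI)
    show "group (add_monoid (stalk M m))" by (rule R.add.is_group)
    show "{X \<in> carrier (stalk M m). germ_value X = 0} \<noteq> {}"
      using germ_value_zero R.zero_closed by blast
  next
    fix X assume X: "X \<in> {X \<in> carrier (stalk M m). germ_value X = 0}"
    then have "germ_value X + germ_value (\<ominus>\<^bsub>stalk M m\<^esub> X) = 0"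
      using germ_value_add[of X "\<ominus>\<^bsub>stalk M m\<^esub> X"] by (simp add: R.r_neg germ_value_zero)
    then show "inv\<^bsub>add_monoid (stalk M m)\<^esub> X \<in> {X \<in> carrier (stalk M m). germ_value X = 0}"
      using X by (simp flip: a_inv_def)
  qed (auto simp: germ_value_add)
qed (auto simp: germ_value_mult)

end

end

context point_evaluation
begin

lemma germ_value_component:
  assumes "i \<in> Z2n n" "i \<noteq> z2_zero n" "X \<in> component (stalk M m) i"
  shows "germ_value X = 0"
proof -
  obtain U s where U: "openin (base_space M) U" "m \<in> U" "s \<in> component (sections M U) i"
    "X = germ M m U s"
    using assms(3) by (auto simp: stalk_def)
  have "(U, s) \<in> X"
    using U component_section[OF U(1) assms(1)] by (simp add: germ_self)
  then show ?thesis
    using germ_value_eq[OF stalk_component_carrier[OF assms(1,3)]] component_character[OF U(1,2) assms(1,2) U(3)]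
    by simp
qed

text \<open>The germ of a local inverse inverts the germ; by \<open>stalk_carrier_eqI\<close> it
  suffices that the product and the unit of the stalk share the representative given by the unit
  section over \<open>W\<close>.\<close>

lemma stalk_right_inverse:
  assumes ring: "ring (stalk M m)" and m: "m \<in> topspace (base_space M)"
    and X: "X \<in> carrier (stalk M m)" and nz: "germ_value X \<noteq> 0"
  shows "\<exists>Y\<in>carrier (stalk M m). X \<otimes>\<^bsub>stalk M m\<^esub> Y = \<one>\<^bsub>stalk M m\<^esub>"
proof -
  interpret R: ring "stalk M m" by fact
  obtain U s where U: "openin (base_space M) U" "m \<in> U" "s \<in> carrier (sections M U)"
    and s: "(U, s) \<in> X"
    using X by (rule stalk_carrierE)
  obtain W where W: "openin (base_space M) W" "m \<in> W" "W \<subseteq> U"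
    and "restriction M U W s \<in> Units (sections M W)"
    using locally_unit[OF U] nz germ_value_eq[OF X s] by auto
  then obtain t where t: "t \<in> carrier (sections M W)"
    and inv: "restriction M U W s \<otimes>\<^bsub>sections M W\<^esub> t = \<one>\<^bsub>sections M W\<^esub>"
    by (auto simp: Units_def)
  let ?Y = "germ M m W t" and ?T = "topspace (base_space M)"
  have Y: "?Y \<in> carrier (stalk M m)"
    using W t by (auto simp: stalk_def)
  have "U \<inter> W = W" using W(3) by blast
  then have "(W, \<one>\<^bsub>sections M W\<^esub>) \<in> germ M m (U \<inter> W) (restriction M U (U \<inter> W) s
      \<otimes>\<^bsub>sections M (U \<inter> W)\<^esub> restriction M W (U \<inter> W) t)"
    using W t by (simp add: restriction_id inv germ_self one_section)
  then have "(W, \<one>\<^bsub>sections M W\<^esub>) \<in> X \<otimes>\<^bsub>stalk M m\<^esub> ?Y"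
    using s germ_self[OF W(1,2) t] by (auto simp: stalk_def germ_op2_def)
  moreover have "(W, \<one>\<^bsub>sections M W\<^esub>) \<in> \<one>\<^bsub>stalk M m\<^esub>"
  proof -
    \<comment> \<open>The unit of the stalk is the germ of the global unit section, which restricts
      to the unit over \<open>W\<close>.\<close>
    have "W \<subseteq> ?T" using W(1) by (rule openin_subset)
    then have "restriction M ?T W \<one>\<^bsub>sections M ?T\<^esub> = restriction M W W \<one>\<^bsub>sections M W\<^esub>"
      using W by (simp add: restriction_one restriction_id one_section)
    then show ?thesis
      using W \<open>W \<subseteq> ?T\<close> by (auto simp: stalk_def germ_def one_section)
  qed
  ultimately have "X \<otimes>\<^bsub>stalk M m\<^esub> ?Y = \<one>\<^bsub>stalk M m\<^esub>"
    using stalk_carrier_eqI[OF R.m_closed[OF X Y] R.one_closed] by blast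
  then show ?thesis using Y by blast
qed

text \<open>A member of the maximal ideal with nonzero value would be right invertible and put the
  unit into the ideal. So the ideal lies in the kernel of \<open>germ_value\<close>, a proper
  homogeneous ideal, and maximality gives equality.\<close>

lemma stalk_ideal_eq:
  assumes local: "graded_local n (stalk M m)" and m: "m \<in> topspace (base_space M)"
  shows "stalk_ideal n M m = {X \<in> carrier (stalk M m). germ_value X = 0}"
proof -
  let ?K = "{X \<in> carrier (stalk M m). germ_value X = 0}" and ?I = "stalk_ideal n M m"
  have I: "maximal_homogeneous_ideal n (stalk M m) ?I"
    using theI'[OF local[unfolded graded_local_def]] by (simp add: stalk_ideal_def the_maximal_ideal_def)
  then have idealI: "ideal ?I (stalk M m)" and neq: "?I \<noteq> carrier (stalk M m)"
    by (simp_all add: maximal_homogeneous_ideal_def homogeneous_ideal_def)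
  interpret I: ideal ?I "stalk M m" by (rule idealI)
  \<comment> \<open>Being an ideal includes the ring laws of the ambient structure, so the locality
    of the stalk supplies them.\<close>
  have ring: "ring (stalk M m)" by (rule I.ring_axioms)
  have "?I \<subseteq> ?K"
  proof
    fix X assume X: "X \<in> ?I"
    then have Xc: "X \<in> carrier (stalk M m)" by (rule I.Icarr)
    have "germ_value X = 0"
    proof (rule ccontr)
      assume "germ_value X \<noteq> 0"
      then have "\<one>\<^bsub>stalk M m\<^esub> \<in> ?I"
        using stalk_right_inverse[OF ring m Xc] I.I_r_closed[OF X] by metis
      then show False using I.one_imp_carrier neq by blast
    qed
    with Xc show "X \<in> ?K" by simp
  qed
  moreover have "homogeneous_ideal n (stalk M m) ?K"
    unfolding homogeneous_ideal_def
  proof (intro conjI ballI impI)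
    show "ideal ?K (stalk M m)" using ring m by (rule ideal_germ_value_zero)
    fix c i assume c: "c \<in> (\<Pi>\<^sub>E i\<in>Z2n n. component (stalk M m) i)"
      and K: "finsum (stalk M m) c (Z2n n) \<in> ?K" and i: "i \<in> Z2n n"
    have comp: "c j \<in> component (stalk M m) j" if "j \<in> Z2n n" for j
      using c that by auto
    then have carr: "c j \<in> carrier (stalk M m)" if "j \<in> Z2n n" for j
      using that stalk_component_carrier by blast
    \<comment> \<open>Components of nonzero degree have value zero, so the value of the sum is that
      of the degree-zero component, which must vanish too.\<close>
    have "0 = (\<Sum>j\<in>Z2n n. germ_value (c j))"
      using K germ_value_finsum[OF ring m finite_Z2n, of c] carr by auto
    also have "\<dots> = germ_value (c (z2_zero n))"
      using germ_value_component[OF _ _ comp] finite_Z2n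
      by (subst sum.remove[OF _ zero_in_Z2n]) (auto intro: sum.neutral)
    finally have "germ_value (c i) = 0"
      using germ_value_component[OF i _ comp[OF i]] by (cases "i = z2_zero n") auto
    then show "c i \<in> ?K" using carr[OF i] by simp
  qed
  moreover have "?K \<noteq> carrier (stalk M m)"
  proof
    assume "?K = carrier (stalk M m)"
    then have "\<one>\<^bsub>stalk M m\<^esub> \<in> ?K" using I.one_closed by blast
    then show False using germ_value_one[OF ring m] by simp
  qed
  ultimately show ?thesis
    using I unfolding maximal_homogeneous_ideal_def by blast
qed

end

section \<open>Induced stalk maps and the comparison of ideals\<close>

context z2n_morphism
begin

text \<open>The union defining \<open>stalk_map\<close> runs over all representatives. Two of them
  agree on some \<open>W\<close>, hence their pullbacks agree on the preimage of \<open>W\<close>,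
  and every term of the union is the same germ.\<close>

lemma stalk_map_germ:
  assumes "z2n_presheaf n M" "z2n_presheaf n N" and m: "m \<in> topspace (base_space M)"
    and V: "openin (base_space N) V" "\<psi> m \<in> V" "t \<in> carrier (sections N V)"
  shows "stalk_map M \<psi> \<psi>s m (germ N (\<psi> m) V t) = germ M m (preimage M \<psi> V) (\<psi>s V t)"
proof -
  interpret M: z2n_presheaf n M by fact
  interpret N: z2n_presheaf n N by fact
  have mem: "m \<in> preimage M \<psi> W" if "\<psi> m \<in> W" for W
    using m that by (simp add: preimage_def)
  have "germ M m (preimage M \<psi> V') (\<psi>s V' t') = germ M m (preimage M \<psi> V) (\<psi>s V t)"
    if V't': "(V', t') \<in> germ N (\<psi> m) V t" for V' t'
  proof (rule M.germ_eq)
    obtain W where V': "openin (base_space N) V'" "\<psi> m \<in> V'" "t' \<in> carrier (sections N V')"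
      and W: "openin (base_space N) W" "\<psi> m \<in> W" "W \<subseteq> V" "W \<subseteq> V'"
      and eq: "restriction N V W t = restriction N V' W t'"
      using V't' by (auto simp: germ_def)
    have "restriction M (preimage M \<psi> V) (preimage M \<psi> W) (\<psi>s V t) =
        restriction M (preimage M \<psi> V') (preimage M \<psi> W) (\<psi>s V' t')"
      using pullback_restriction[OF V(1) W(1,3) V(3)] pullback_restriction[OF V'(1) W(1,4) V'(3)] eq
      by simp
    then show "(preimage M \<psi> V', \<psi>s V' t') \<in> germ M m (preimage M \<psi> V) (\<psi>s V t)"
      using openin_preimage[OF V'(1)] mem[OF V'(2)] pullback_closed[OF V'(1,3)]
        openin_preimage[OF W(1)] mem[OF W(2)] preimage_mono[OF W(3)] preimage_mono[OF W(4)]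
      unfolding germ_def by blast
  qed (use V mem openin_preimage pullback_closed in auto)
  then show ?thesis
    using N.germ_self[OF V] unfolding stalk_map_def by fast
qed

end

theorem corollary6p5:
  fixes n p p' :: nat and q q' :: "nat list"
    and M :: "('m, 'a) algebraed_space" and N :: "('k, 'b) algebraed_space"
    and \<psi> :: "'m \<Rightarrow> 'k" and \<psi>s :: "'k set \<Rightarrow> 'b \<Rightarrow> 'a"
  assumes "z2n_supermanifold n p q M"
    and "z2n_supermanifold n p' q' N"
    and "z2n_morphism n M N \<psi> \<psi>s"
  shows "(\<forall>V. openin (base_space N) V \<longrightarrow>
            \<psi>s V ` base_kernel N V \<subseteq> base_kernel M (preimage M \<psi> V)) \<and>
         (\<forall>m\<in>topspace (base_space M).
            stalk_map M \<psi> \<psi>s m ` stalk_ideal n N (\<psi> m) \<subseteq> stalk_ideal n M m)"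
proof -
  interpret M: z2n_supermanifold n p q M by fact
  interpret N: z2n_supermanifold n p' q' N by fact
  interpret z2n_morphism n M N \<psi> \<psi>s by fact
  have \<psi>: "\<psi> m \<in> topspace (base_space N)" if "m \<in> topspace (base_space M)" for m
    using continuous_map_image_subset_topspace[OF continuous] that by auto
  \<comment> \<open>Pulled back along the morphism, the evaluation at \<open>m\<close> is a
    character at \<open>\<psi> m\<close>, so uniqueness identifies it with the evaluation there.
    Both inclusions follow from this identity.\<close>
  have eval: "\<exists>\<theta> \<theta>'. point_evaluation n M m \<theta> \<and> point_evaluation n N (\<psi> m) \<theta>' \<and>
      (\<forall>V t. openin (base_space N) V \<longrightarrow> \<psi> m \<in> V \<longrightarrow> t \<in> carrier (sections N V) \<longrightarrow>
        \<theta> (preimage M \<psi> V) (\<psi>s V t) = \<theta>' V t)"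
    if m: "m \<in> topspace (base_space M)" for m
  proof -
    obtain \<theta> where \<theta>: "point_evaluation n M m \<theta>"
      using M.ex_point_evaluation[OF m] by blast
    obtain \<theta>' where \<theta>': "point_evaluation n N (\<psi> m) \<theta>'"
      using N.ex_point_evaluation[OF \<psi>[OF m]] by blast
    interpret \<theta>: point_evaluation n M m \<theta> by fact
    interpret \<theta>': point_evaluation n N "\<psi> m" \<theta>' by fact
    show ?thesis
      using \<theta> \<theta>' \<theta>'.character_unique[OF pullback_character[OF \<theta>.point_character_axioms
          N.z2n_presheaf_axioms m]] by blast
  qed
  show ?thesis
  proof (intro conjI allI ballI impI image_subsetI)
    fix V t assume V: "openin (base_space N) V" and t: "t \<in> base_kernel N V"
    then have tc: "t \<in> carrier (sections N V)" by (simp add: base_kernel_def)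
    \<comment> \<open>Both base projections are evaluations, so the one at \<open>m\<close> equals
      the one of \<open>t\<close> at \<open>\<psi> m\<close>, which is zero.\<close>
    have "base_projection M (preimage M \<psi> V) (\<psi>s V t) m = 0" if m: "m \<in> preimage M \<psi> V" for m
    proof -
      have m': "m \<in> topspace (base_space M)" "\<psi> m \<in> V" using m by (simp_all add: preimage_def)
      obtain \<theta> \<theta>' where "point_evaluation n M m \<theta>" "point_evaluation n N (\<psi> m) \<theta>'"
        and eq: "\<theta> (preimage M \<psi> V) (\<psi>s V t) = \<theta>' V t"
        using eval[OF m'(1)] V m'(2) tc by blast
      then show ?thesis
        using point_evaluation.base_projection_eq[OF _ openin_preimage[OF V] m pullback_closed[OF V tc]]
          point_evaluation.base_projection_eq[OF _ V m'(2) tc] t m'(2)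
        by (simp add: base_kernel_def)
    qed
    then show "\<psi>s V t \<in> base_kernel M (preimage M \<psi> V)"
      using pullback_closed[OF V tc] by (simp add: base_kernel_def)
  next
    fix m X assume m: "m \<in> topspace (base_space M)" and X: "X \<in> stalk_ideal n N (\<psi> m)"
    obtain \<theta> \<theta>' where \<theta>: "point_evaluation n M m \<theta>" and \<theta>': "point_evaluation n N (\<psi> m) \<theta>'"
      and eq: "\<And>V t. openin (base_space N) V \<Longrightarrow> \<psi> m \<in> V \<Longrightarrow> t \<in> carrier (sections N V) \<Longrightarrow>
        \<theta> (preimage M \<psi> V) (\<psi>s V t) = \<theta>' V t"
      using eval[OF m] by blast
    interpret \<theta>: point_evaluation n M m \<theta> by fact
    interpret \<theta>': point_evaluation n N "\<psi> m" \<theta>' by fact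
    have Xc: "X \<in> carrier (stalk N (\<psi> m))" and X0: "\<theta>'.germ_value X = 0"
      using X \<theta>'.stalk_ideal_eq[OF N.local_stalks[OF \<psi>[OF m]] \<psi>[OF m]] by simp_all
    obtain V t where V: "openin (base_space N) V" "\<psi> m \<in> V" "t \<in> carrier (sections N V)"
      and Xeq: "X = germ N (\<psi> m) V t" and mem: "(V, t) \<in> X"
      using Xc by (rule N.stalk_carrierE)
    let ?V = "preimage M \<psi> V"
    have map: "stalk_map M \<psi> \<psi>s m X = germ M m ?V (\<psi>s V t)"
      unfolding Xeq by (rule stalk_map_germ[OF M.z2n_presheaf_axioms N.z2n_presheaf_axioms m V])
    have V': "openin (base_space M) ?V" "m \<in> ?V" "\<psi>s V t \<in> carrier (sections M ?V)"
      using V m openin_preimage pullback_closed by (auto simp: preimage_def)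
    then have carr: "germ M m ?V (\<psi>s V t) \<in> carrier (stalk M m)"
      by (auto simp: stalk_def)
    \<comment> \<open>The image germ has the same value as \<open>X\<close>, namely zero, and so
      lies in the kernel that is the maximal ideal at \<open>m\<close>.\<close>
    have "\<theta>.germ_value (germ M m ?V (\<psi>s V t)) = \<theta>' V t"
      using \<theta>.germ_value_eq[OF carr M.germ_self[OF V']] eq[OF V] by simp
    then show "stalk_map M \<psi> \<psi>s m X \<in> stalk_ideal n M m"
      using carr X0 \<theta>'.germ_value_eq[OF Xc mem]
      by (simp add: map \<theta>.stalk_ideal_eq[OF M.local_stalks[OF m] m])
  qed
qed

end
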